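(* Let $\{s_n\}_{n\in\mathbb{N}}\subset(-d,0)$ be such that $s_n\to0^-$ as $n\to+\infty$. Let $\{E_n\}_{n\in\mathbb{N}}\subset\mathfrak{C}$ be such that $E_n\to E$ in $\mathfrak{C}$ for some $E\in\mathfrak{C}$. For every $x\in\partial E\cap\partial E_n$ (i.e. $x$ belonging to $\partial E$ and to $\partial E_n$ for all $n$) it holds $$\lim_{n\to+\infty}\Big(\mathcal{K}^{s_n}(x,E_n)-\frac{d\omega_d}{s_n}\Big)=\mathrm{H}^0(x,E).$$ In particular, $$\lim_{n\to+\infty}s_n\mathcal{K}^{s_n}(x,E_n)=d\omega_d.$$
   Context: $\omega_d$ is the volume of the unit ball of $\mathbb{R}^d$. Fix an integer $\ell\ge 2$ and $\beta\in[0,1]$. $\mathfrak{C}$ is the class of subsets of $\mathbb{R}^d$ that are the closure of an open set with compact $C^{\ell,\beta}$ boundary. $E_n\to E$ in $\mathfrak{C}$ means that there are diffeomorphisms $\Phi_n$ converging to the identity in $C^{\ell,\beta}$ with $E_n=\Phi_n(E)$. $B_\rho(x)$ is the open ball of radius $\rho$ centred at $x$. For $s\in(-d,0)$, $E\in\mathfrak{C}$, $x\in\partial E$, the $s$-Riesz curvature is $$\mathcal{K}^s(x,E)=-2\int_E\frac{dy}{|x-y|^{d+s}}\ \text{ if }E\text{ is bounded},\qquad \mathcal{K}^s(x,E)=2\int_{\mathbb{R}^d\setminus E}\frac{dy}{|x-y|^{d+s}}\ \text{ if }\mathbb{R}^d\setminus E\text{ is bounded}.$$ The $0$-fractional curvature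 is $$\mathrm{H}^0(x,E)=\lim_{R\to+\infty}\Big[\lim_{r\to0^+}\int_{B_R(x)\setminus B_r(x)}\frac{\chi_{\mathbb{R}^d\setminus E}(y)-\chi_E(y)}{|x-y|^{d}}\,dy-d\omega_d\log R\Big]\quad\text{if }E\text{ is bounded},$$ $$\mathrm{H}^0(x,E)=\lim_{R\to+\infty}\Big[\lim_{r\to0^+}\int_{B_R(x)\setminus B_r(x)}\frac{\chi_{\mathbb{R}^d\setminus E}(y)-\chi_E(y)}{|x-y|^{d}}\,dy+d\omega_d\log R\Big]\quad\text{if }\mathbb{R}^d\setminus E\text{ is bounded}.$$
   Formalization: If R^d∖E is bounded the printed sign is wrong (for E_n=E the complement of the open unit ball the expression tends to +∞); there the result is proved with +dω_d/s_n in the first limit and -dω_d as the second. For bounded E it is as printed. *)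

theory Defs
  imports "HOL-Analysis.Analysis"
begin

text \<open>Iterated directional derivatives; along lists of basis vectors these are the partial
  derivatives of order equal to the length of the list.\<close>

primrec iter_deriv ::
  "'a::real_normed_vector list \<Rightarrow> ('a \<Rightarrow> 'b::real_normed_vector) \<Rightarrow> 'a \<Rightarrow> 'b" where
  "iter_deriv [] f = f"
| "iter_deriv (v # vs) f = iter_deriv vs (\<lambda>x. frechet_derivative f (at x) v)"

text \<open>The class \<open>C\<^sup>k\<^sup>,\<^sup>\<beta>\<close> on an open set, the Hoelder condition on the derivatives of order \<open>k\<close> being
  required on compact subsets. For \<open>\<beta> = 0\<close> that condition is implied by continuity, so the class is
  \<open>C\<^sup>k\<close>. (Note \<open>0 powr 0 = 0\<close>, which is harmless as both sides vanish for \<open>x = y\<close>.)\<close>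

definition C_holder_on ::
  "nat \<Rightarrow> real \<Rightarrow> 'a::euclidean_space set \<Rightarrow> ('a \<Rightarrow> 'b::real_normed_vector) \<Rightarrow> bool" where
  "C_holder_on k \<beta> S f \<longleftrightarrow>
     (\<forall>vs. set vs \<subseteq> Basis \<and> length vs < k \<longrightarrow> (\<forall>x\<in>S. iter_deriv vs f differentiable (at x))) \<and>
     (\<forall>vs. set vs \<subseteq> Basis \<and> length vs \<le> k \<longrightarrow> continuous_on S (iter_deriv vs f)) \<and>
     (\<forall>vs. set vs \<subseteq> Basis \<and> length vs = k \<longrightarrow>
        (\<forall>K. compact K \<and> K \<subseteq> S \<longrightarrow>
          (\<exists>C. \<forall>x\<in>K. \<forall>y\<in>K. norm (iter_deriv vs f x - iter_deriv vs f y) \<le> C * dist x y powr \<beta>)))"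

text \<open>Near each of its boundary points, the open set \<open>U\<close> is the subgraph, in some direction \<open>\<nu>\<close>, of a
  \<open>C\<^sup>k\<^sup>,\<^sup>\<beta>\<close> function of the orthogonal projection \<open>x - (x \<bullet> \<nu>) \<nu>\<close> of \<open>x\<close> onto the hyperplane normal to
  \<open>\<nu>\<close>. A function on the hyperplane is represented by an extension \<open>g\<close> to the ambient space (for
  instance the one that is constant along \<open>\<nu>\<close>); only its values on the hyperplane matter.\<close>

definition C_holder_boundary :: "nat \<Rightarrow> real \<Rightarrow> 'a::euclidean_space set \<Rightarrow> bool" where
  "C_holder_boundary k \<beta> U \<longleftrightarrow>
     (\<forall>p\<in>frontier U. \<exists>\<nu> r. \<exists>g :: 'a \<Rightarrow> real.
        norm \<nu> = 1 \<and> r > 0 \<and>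
        C_holder_on k \<beta> (ball (p - (p \<bullet> \<nu>) *\<^sub>R \<nu>) r) g \<and>
        (\<forall>x\<in>ball p r. x \<in> U \<longleftrightarrow> x \<bullet> \<nu> < g (x - (x \<bullet> \<nu>) *\<^sub>R \<nu>)))"

definition regular_sets :: "nat \<Rightarrow> real \<Rightarrow> 'a::euclidean_space set set" where
  "regular_sets k \<beta> =
     {E. \<exists>U. open U \<and> E = closure U \<and> compact (frontier U) \<and> C_holder_boundary k \<beta> U}"

definition C_holder_diffeo ::
  "nat \<Rightarrow> real \<Rightarrow> ('a::euclidean_space \<Rightarrow> 'a) \<Rightarrow> bool" where
  "C_holder_diffeo k \<beta> \<Phi> \<longleftrightarrow>
     bij \<Phi> \<and> C_holder_on k \<beta> UNIV \<Phi> \<and> C_holder_on k \<beta> UNIV (inv \<Phi>)"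

text \<open>Convergence to \<open>g\<close> in the (global) \<open>C\<^sup>k\<^sup>,\<^sup>\<beta>\<close> norm, i.e. the sum of the sup norms of the
  derivatives up to order \<open>k\<close> and the \<open>\<beta>\<close>-Hoelder seminorms of those of order \<open>k\<close>.\<close>

definition C_holder_converges ::
  "nat \<Rightarrow> real \<Rightarrow> (nat \<Rightarrow> 'a::euclidean_space \<Rightarrow> 'b::real_normed_vector) \<Rightarrow> ('a \<Rightarrow> 'b) \<Rightarrow> bool" where
  "C_holder_converges k \<beta> f g \<longleftrightarrow>
     (\<forall>vs. set vs \<subseteq> Basis \<and> length vs \<le> k \<longrightarrow>
        uniform_limit UNIV (\<lambda>n. iter_deriv vs (f n)) (iter_deriv vs g) sequentially) \<and>
     (\<forall>vs. set vs \<subseteq> Basis \<and> length vs = k \<longrightarrow>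
        (\<forall>\<epsilon>>0. \<forall>\<^sub>F n in sequentially. \<forall>x y.
           norm ((iter_deriv vs (f n) x - iter_deriv vs g x) - (iter_deriv vs (f n) y - iter_deriv vs g y))
             \<le> \<epsilon> * dist x y powr \<beta>))"

definition regular_sets_converge ::
  "nat \<Rightarrow> real \<Rightarrow> (nat \<Rightarrow> 'a::euclidean_space set) \<Rightarrow> 'a set \<Rightarrow> bool" where
  "regular_sets_converge k \<beta> En E \<longleftrightarrow>
     (\<exists>\<Phi>. (\<forall>n. C_holder_diffeo k \<beta> (\<Phi> n) \<and> En n = \<Phi> n ` E) \<and>
          C_holder_converges k \<beta> \<Phi> (\<lambda>x. x))"

text \<open>\<open>d \<omega>\<^sub>d\<close>, with \<open>\<omega>\<^sub>d\<close> the volume of the unit ball.\<close>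

definition d_omega :: "'a::euclidean_space itself \<Rightarrow> real" where
  "d_omega _ = real DIM('a) * measure lborel (ball (0::'a) 1)"

definition riesz_curvature :: "real \<Rightarrow> 'a::euclidean_space \<Rightarrow> 'a set \<Rightarrow> real" where
  "riesz_curvature s x E =
     (if bounded E then - 2 * (LINT y:E|lborel. 1 / norm (x - y) powr (real DIM('a) + s))
      else if bounded (- E) then 2 * (LINT y:- E|lborel. 1 / norm (x - y) powr (real DIM('a) + s))
      else undefined)"

definition annular_integral :: "'a::euclidean_space \<Rightarrow> 'a set \<Rightarrow> real \<Rightarrow> real \<Rightarrow> real" where
  "annular_integral x E R r =
     (LINT y:ball x R - ball x r|lborel.
        (indicator (- E) y - indicator E y) / norm (x - y) ^ DIM('a))"

definition zero_curvature :: "'a::euclidean_space \<Rightarrow> 'a set \<Rightarrow> real" where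
  "zero_curvature x E =
     (if bounded E then
        Lim at_top (\<lambda>R. Lim (at_right 0) (annular_integral x E R) - d_omega TYPE('a) * ln R)
      else if bounded (- E) then
        Lim at_top (\<lambda>R. Lim (at_right 0) (annular_integral x E R) + d_omega TYPE('a) * ln R)
      else undefined)"

end

theory Submission
  imports Defs
begin

text \<open>Let \<open>A\<close> be the bounded one of \<open>E\<close> and its complement, and \<open>A\<^sub>n\<close> the corresponding one for \<open>E\<^sub>n\<close>.
  If the ball \<open>B\<^sub>R(x)\<close> contains all of these sets, then \<open>\<integral>\<^bsub>B\<^sub>R(x)\<^esub> |x - y|\<^bsup>-d-s\<^esup> dy = d \<omega>\<^sub>d R\<^bsup>-s\<^esup> / (-s)\<close>
  turns the claim, up to the limit \<open>ln R\<close> of \<open>(1 - R\<^bsup>-s\<^esup>) / s\<close>, into the convergence of the integrals over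
  \<open>B\<^sub>R(x)\<close> of \<open>1\<^bsub>-A\<^sub>n\<^esub> - 1\<^bsub>A\<^sub>n\<^esub>\<close> against the kernel. Off a small ball \<open>B\<^sub>r(x)\<close> this is dominated
  convergence, the frontier of \<open>E\<close> being negligible. On \<open>B\<^sub>r(x)\<close> the reflection \<open>y \<mapsto> 2 x - y\<close> cancels the
  integrand except where \<open>|q\<^sub>n \<bullet> (y - x)| \<le> C |y - x|\<^sup>2\<close>, with \<open>q\<^sub>n\<close> normal to \<open>E\<^sub>n\<close> at \<open>x\<close>; the rest is
  \<open>O(r)\<close>, uniformly in \<open>n\<close>, because the \<open>C\<^sup>2\<close> convergence makes \<open>C\<close> independent of \<open>n\<close>.\<close>

section \<open>Packing by translates and radial integration\<close>

text \<open>Translation preserves measure and disjoint measures add up inside \<open>T\<close>. Both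
  volume estimates below, for thin slabs and for graphs, come from this count of translates, so no
  integration over hyperplanes is involved.\<close>

lemma measure_packing_le:
  fixes S T :: "'a::euclidean_space set"
  assumes S: "S \<in> lmeasurable" and T: "T \<in> lmeasurable"
    and sub: "\<And>i. i < N \<Longrightarrow> (+) (f i) ` S \<subseteq> T"
    and disj: "disjoint_family_on (\<lambda>i. (+) (f i) ` S) {..<N::nat}"
  shows "real N * measure lebesgue S \<le> measure lebesgue T"
proof -
  have "real N * measure lebesgue S = (\<Sum>i<N. measure lebesgue ((+) (f i) ` S))"
    by (simp add: measure_translation)
  also have "\<dots> = measure lebesgue (\<Union>i<N. (+) (f i) ` S)"
    by (rule measure_UNION'[symmetric])
       (use S disj in \<open>auto simp: disjoint_family_on_def pairwise_def disjnt_def measurable_translation\<close>)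
  also have "\<dots> \<le> measure lebesgue T"
    using S T sub by (intro measure_mono_fmeasurable) (auto intro!: fmeasurableD fmeasurable.finite_UN measurable_translation)
  finally show ?thesis .
qed

text \<open>Since \<open>1/2 \<le> norm q\<close>, the slab has width at most \<open>4 * h\<close>
  in the direction of \<open>q\<close>, so its translates by multiples of \<open>5 * h\<close> in
  that direction are disjoint. About \<open>\<rho> / (5 * h)\<close> of them fit into the ball of
  radius \<open>2 * \<rho>\<close>.\<close>

lemma measure_slab_le:
  fixes q :: "'a::euclidean_space"
  assumes q: "1/2 \<le> norm q" and h: "0 < h" and \<rho>: "0 < \<rho>"
  shows "measure lborel (cball 0 \<rho> \<inter> {z. \<bar>q \<bullet> z\<bar> \<le> h})
           \<le> 5 * h / \<rho> * ((2 * \<rho>) ^ DIM('a) * measure lborel (ball (0::'a) 1))"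
proof -
  define S where "S = cball 0 \<rho> \<inter> {z. \<bar>q \<bullet> z\<bar> \<le> h}"
  have clS: "closed {z. \<bar>q \<bullet> z\<bar> \<le> h}"
    by (intro closed_Collect_le continuous_intros)
  have S: "S \<in> lmeasurable" "compact S"
    unfolding S_def by (auto intro!: lmeasurable_compact compact_Int_closed clS)
  \<comment> \<open>The rounding serves two bounds: \<open>N\<close> is at least
    \<open>\<rho> / (5 * h)\<close>, while every shift with index below \<open>N\<close> still has
    length at most \<open>\<rho>\<close>.\<close>
  define N where "N = nat \<lfloor>\<rho> / (5*h)\<rfloor> + 1"
  have N1: "\<rho> / (5*h) \<le> real N" unfolding N_def by linarith
  have N2: "real i * (5*h) \<le> \<rho>" if "i < N" for i
  proof -
    have "0 \<le> \<rho> / (5*h)" using h \<rho> by simp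
    then have "real i \<le> \<rho> / (5*h)" using that unfolding N_def by linarith
    then show ?thesis using h by (simp add: field_simps)
  qed
  define e where "e = q /\<^sub>R norm q"
  have q0: "norm q > 0" using q by linarith
  have e: "norm e = 1" "q \<bullet> e = norm q" using q0
    by (auto simp: e_def dot_square_norm power2_eq_square)
  have "real N * measure lebesgue S \<le> measure lebesgue (cball (0::'a) (2*\<rho>))"
  proof (rule measure_packing_le[where f="\<lambda>i. (real i * (5*h)) *\<^sub>R e"])
    show "(+) ((real i * (5*h)) *\<^sub>R e) ` S \<subseteq> cball 0 (2*\<rho>)" if "i < N" for i
    proof clarify
      fix z assume z: "z \<in> S"
      have "norm ((real i * (5*h)) *\<^sub>R e + z) \<le> real i * (5*h) + norm z"
        by (rule norm_triangle_le) (use h e in \<open>simp add: abs_mult\<close>)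
      also have "\<dots> \<le> 2*\<rho>" using N2[OF that] z by (simp add: S_def)
      finally show "(real i * (5*h)) *\<^sub>R e + z \<in> cball 0 (2*\<rho>)" by simp
    qed
    show "disjoint_family_on (\<lambda>i. (+) ((real i * (5*h)) *\<^sub>R e) ` S) {..<N}"
      unfolding disjoint_family_on_def
    proof (intro ballI impI)
      fix i j :: nat assume "i \<noteq> j"
      show "(+) ((real i * (5*h)) *\<^sub>R e) ` S \<inter> (+) ((real j * (5*h)) *\<^sub>R e) ` S = {}"
      proof (rule ccontr)
        assume "\<not> ?thesis"
        then obtain z w where zw: "z \<in> S" "w \<in> S"
          "(real i * (5*h)) *\<^sub>R e + z = (real j * (5*h)) *\<^sub>R e + w" by auto
        have "q \<bullet> ((real i * (5*h)) *\<^sub>R e + z) = q \<bullet> ((real j * (5*h)) *\<^sub>R e + w)"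
          using zw by simp
        then have "(real i - real j) * (5*h*norm q) = q \<bullet> w - q \<bullet> z"
          by (simp add: inner_add_right e algebra_simps)
        moreover have "\<bar>q \<bullet> w - q \<bullet> z\<bar> \<le> 2 * h" using zw by (auto simp: S_def)
        ultimately have "\<bar>(real i - real j) * (5*h*norm q)\<bar> \<le> 2*h" by simp
        then have "\<bar>real i - real j\<bar> * (5*h*norm q) \<le> 2*h"
          using h by (simp add: abs_mult)
        moreover have "1 * (5*h*norm q) \<le> \<bar>real i - real j\<bar> * (5*h*norm q)"
          using \<open>i \<noteq> j\<close> h q0 by (intro mult_right_mono) auto
        moreover have "5*h*(1/2) \<le> 5*h*norm q" using q h by (intro mult_left_mono) auto
        ultimately show False using h by linarith
      qed
    qed
  qed (use S in auto)
  also have "measure lebesgue (cball (0::'a) (2*\<rho>)) = (2*\<rho>) ^ DIM('a) * measure lborel (ball (0::'a) 1)"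
    using \<rho> content_ball_conv_unit_ball[of "2*\<rho>" "0::'a"] content_cball_conv_ball[of "0::'a" "2*\<rho>"] by simp
  finally have "real N * measure lebesgue S \<le> (2*\<rho>) ^ DIM('a) * measure lborel (ball (0::'a) 1)" .
  then have "\<rho> / (5*h) * measure lebesgue S \<le> (2*\<rho>) ^ DIM('a) * measure lborel (ball (0::'a) 1)"
    using mult_right_mono[OF N1, of "measure lebesgue S"] by simp
  then have "measure lebesgue S \<le> 5*h/\<rho> * ((2*\<rho>) ^ DIM('a) * measure lborel (ball (0::'a) 1))"
    using h \<rho> by (simp add: field_simps)
  moreover have "measure lebesgue S = measure lborel S"
    using S by (simp add: borel_compact)
  ultimately show ?thesis by (simp add: S_def)
qed

text \<open>The vertical translates of a graph are pairwise disjoint.\<close>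

lemma negligible_bounded_graph:
  fixes S :: "'a::euclidean_space set" and u :: "'a \<Rightarrow> real"
  assumes S: "compact S" and \<nu>: "norm \<nu> = 1" and r: "0 < r" and sub: "S \<subseteq> ball p (r/2)"
    and u0: "\<And>y. y \<in> S \<Longrightarrow> u y = 0"
    and ut: "\<And>y t. y \<in> ball p r \<Longrightarrow> y + t *\<^sub>R \<nu> \<in> ball p r \<Longrightarrow> u (y + t *\<^sub>R \<nu>) = u y + t"
  shows "negligible S"
proof -
  have Sm: "S \<in> lmeasurable" using S by (rule lmeasurable_compact)
  have le: "real N * measure lebesgue S \<le> measure lebesgue (ball p r)" for N
  \<comment> \<open>The shifts \<open>i / N * (r / 2)\<close> stay below \<open>r / 2\<close>, so
    for every \<open>N\<close> all translates remain in \<open>ball p r\<close>. They are disjoint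
    because \<open>u\<close> is constant on each translate and equal to its shift. A ball of finite
    measure thus contains arbitrarily many disjoint copies of \<open>S\<close>.\<close>
  proof (rule measure_packing_le[where f="\<lambda>i. (real i / real N * (r/2)) *\<^sub>R \<nu>"])
    have in_ball: "(real i / real N * (r/2)) *\<^sub>R \<nu> + y \<in> ball p r" if "i < N" "y \<in> S" for i y
    proof -
      have "dist p ((real i / real N * (r/2)) *\<^sub>R \<nu> + y) \<le> dist p y + real i / real N * (r/2)"
        using r \<nu> norm_triangle_ineq4[of "p - y" "(real i / real N * (r/2)) *\<^sub>R \<nu>"]
        by (simp add: dist_norm algebra_simps)
      also have "real i / real N * (r/2) \<le> 1 * (r/2)"
        using that r by (intro mult_right_mono) auto
      also have "dist p y < r/2" using that sub by auto
      finally show ?thesis by simp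
    qed
    show "(+) ((real i / real N * (r/2)) *\<^sub>R \<nu>) ` S \<subseteq> ball p r" if "i < N" for i
      using in_ball[OF that] by blast
    show "disjoint_family_on (\<lambda>i. (+) ((real i / real N * (r/2)) *\<^sub>R \<nu>) ` S) {..<N}"
      unfolding disjoint_family_on_def
    proof (intro ballI impI)
      fix i j :: nat assume ij: "i \<in> {..<N}" "j \<in> {..<N}" "i \<noteq> j"
      have u: "u ((real k / real N * (r/2)) *\<^sub>R \<nu> + y) = real k / real N * (r/2)"
        if "k < N" "y \<in> S" for k y
        using ut[of y "real k / real N * (r/2)"] in_ball[OF that] u0[OF that(2)] sub that r
        by (auto simp: add.commute subset_iff)
      show "(+) ((real i / real N * (r/2)) *\<^sub>R \<nu>) ` S \<inter> (+) ((real j / real N * (r/2)) *\<^sub>R \<nu>) ` S = {}"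
      proof (rule ccontr)
        assume "\<not> ?thesis"
        then obtain y w where yw: "y \<in> S" "w \<in> S"
          "(real i / real N * (r/2)) *\<^sub>R \<nu> + y = (real j / real N * (r/2)) *\<^sub>R \<nu> + w" by auto
        have "u ((real i / real N * (r/2)) *\<^sub>R \<nu> + y) = u ((real j / real N * (r/2)) *\<^sub>R \<nu> + w)"
          by (simp only: yw(3))
        then have "real i / real N * (r/2) = real j / real N * (r/2)"
          using u[of i y] u[of j w] ij yw(1,2) by simp
        then show False using ij r by auto
      qed
    qed
  qed (use Sm in auto)
  have "measure lebesgue S = 0"
  proof (rule ccontr)
    assume "measure lebesgue S \<noteq> 0"
    then have "measure lebesgue S > 0" by (simp add: zero_less_measure_iff)
    then obtain N :: nat where "measure lebesgue (ball p r) < real N * measure lebesgue S"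
      using reals_Archimedean3 by blast
    with le[of N] show False by simp
  qed
  then show ?thesis using Sm by (simp add: negligible_iff_measure)
qed

section \<open>Radial functions and point reflections under Lebesgue measure\<close>

lemma emeasure_norm_le:
  "emeasure lborel {y::'a::euclidean_space. norm y \<le> a} =
     (if a < 0 then 0 else ennreal (a ^ DIM('a) * measure lborel (ball (0::'a) 1)))"
proof (cases "a < 0")
  case True
  then have "{y::'a. norm y \<le> a} = {}" using norm_ge_zero order_trans by (auto simp: not_le intro: less_le_trans)
  then show ?thesis using True by simp
next
  case False
  have "{y::'a. norm y \<le> a} = cball 0 a" by auto
  moreover have "emeasure lborel (cball (0::'a) a) = ennreal (measure lborel (cball (0::'a) a))"
    by (intro emeasure_eq_ennreal_measure) (use emeasure_lborel_cball_finite[of "0::'a" a] in auto)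
  ultimately show ?thesis using False content_ball_conv_unit_ball[of a "0::'a"] content_cball_conv_ball[of "0::'a" a]
    by simp
qed

text \<open>Polar coordinates for radial functions. Both measures assign to \<open>{..a}\<close> the
  volume of the ball of radius \<open>a\<close>, the density being the derivative of that volume in
  \<open>a\<close>, and such half-lines generate the Borel sets.\<close>

lemma distr_lborel_norm:
  "distr lborel borel (norm :: 'a::euclidean_space \<Rightarrow> real) =
     density lborel (\<lambda>t. ennreal (d_omega TYPE('a) * t ^ (DIM('a) - 1)) * indicator {0..} t)"
proof (rule measure_eqI_generator_eq[where E="range (\<lambda>a. {..a})" and \<Omega>=UNIV and A="\<lambda>i. {..real i}"])
  show "Int_stable (range (\<lambda>a::real. {..a}))"
    by (auto simp: Int_stable_def)
  have eq1: "emeasure (distr lborel borel (norm :: 'a \<Rightarrow> real)) {..a} =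
     (if a < 0 then 0 else ennreal (a ^ DIM('a) * measure lborel (ball (0::'a) 1)))" for a
    using emeasure_norm_le[where 'a='a, of a] by (simp add: emeasure_distr vimage_def)
  show "emeasure (distr lborel borel (norm :: 'a \<Rightarrow> real)) X = emeasure (density lborel
    (\<lambda>t. ennreal (d_omega TYPE('a) * t ^ (DIM('a) - 1)) * indicator {0..} t)) X"
    if X: "X \<in> range (\<lambda>a. {..a})" for X
  proof -
    obtain a where a: "X = {..a}" using X by auto
    have "emeasure (density lborel
      (\<lambda>t. ennreal (d_omega TYPE('a) * t ^ (DIM('a) - 1)) * indicator {0..} t)) X
      = (\<integral>\<^sup>+t. ennreal (d_omega TYPE('a) * t ^ (DIM('a) - 1)) * indicator {0..a} t \<partial>lborel)"
      by (auto simp: emeasure_density a intro!: nn_integral_cong split: split_indicator)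
    also have "\<dots> = (if a < 0 then 0 else ennreal (a ^ DIM('a) * measure lborel (ball (0::'a) 1)))"
    proof (cases "a < 0")
      case False
      have "(\<integral>\<^sup>+t. ennreal (d_omega TYPE('a) * t ^ (DIM('a) - 1)) * indicator {0..a} t \<partial>lborel)
        = a ^ DIM('a) * measure lborel (ball (0::'a) 1) - 0 ^ DIM('a) * measure lborel (ball (0::'a) 1)"
        by (rule nn_integral_FTC_Icc)
           (use False in \<open>auto intro!: derivative_eq_intros simp: d_omega_def\<close>)
      then show ?thesis using False by simp
    qed auto
    finally show ?thesis using eq1[of a] a by simp
  qed
  show "(\<Union>i. {..real i}) = UNIV" by (auto intro: real_arch_simple)
  show "emeasure (distr lborel borel (norm :: 'a \<Rightarrow> real)) {..real i} \<noteq> \<infinity>" for i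
    using eq1[of "real i"] by simp
qed (auto simp: borel_eq_atMost)

lemma distr_lborel_reflect:
  "distr lborel borel (\<lambda>y. c - y) = (lborel :: 'a::euclidean_space measure)"
proof -
  have "density (distr lborel borel (\<lambda>y. c + (-1) *\<^sub>R y)) (\<lambda>_. ennreal (\<bar>-1\<bar> ^ DIM('a))) = (lborel :: 'a measure)"
    using lborel_affine[of "-1" c] by (metis zero_neq_neg_one)
  then show ?thesis by (simp add: density_1)
qed

lemma nn_integral_lborel_reflect:
  fixes c :: "'a::euclidean_space"
  assumes [measurable]: "f \<in> borel_measurable borel"
  shows "(\<integral>\<^sup>+y. f (c - y) \<partial>lborel) = (\<integral>\<^sup>+y. f y \<partial>lborel)"
proof -
  have "(\<integral>\<^sup>+y. f y \<partial>lborel) = (\<integral>\<^sup>+y. f y \<partial>distr lborel borel (\<lambda>y. c - y))"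
    by (simp add: distr_lborel_reflect)
  then show ?thesis by (simp add: nn_integral_distr)
qed

lemma nn_integral_lborel_norm:
  fixes x :: "'a::euclidean_space"
  assumes [measurable]: "f \<in> borel_measurable borel"
  shows "(\<integral>\<^sup>+y. f (norm (x - y)) \<partial>lborel) =
    (\<integral>\<^sup>+t. ennreal (d_omega TYPE('a) * t ^ (DIM('a) - 1)) * indicator {0..} t * f t \<partial>lborel)"
proof -
  have "(\<integral>\<^sup>+y. f (norm (x - y)) \<partial>lborel) = (\<integral>\<^sup>+t. f t \<partial>distr lborel borel (norm :: 'a \<Rightarrow> real))"
    by (simp add: nn_integral_distr nn_integral_lborel_reflect[of "\<lambda>y. f (norm y)"])
  then show ?thesis by (simp add: distr_lborel_norm nn_integral_density)
qed

section \<open>Cancellation near a boundary point\<close>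

lemma dyadic_scale:
  fixes t r :: real
  assumes "0 < t" "t < r"
  obtains k where "r * (1/2) ^ Suc k \<le> t" "t < r * (1/2) ^ k"
proof -
  have "\<exists>n. r * (1/2) ^ Suc n \<le> t"
  proof -
    obtain n where "(1/2) ^ n < t / r" using real_arch_pow_inv[of "t/r" "1/2"] assms by auto
    then have "r * (1/2) ^ n \<le> t" using assms by (simp add: field_simps)
    moreover have "r * (1/2) ^ Suc n \<le> r * (1/2) ^ n" using assms by simp
    ultimately show ?thesis using order_trans by blast
  qed
  then obtain k where k: "r * (1/2) ^ Suc k \<le> t" "\<And>m. m < k \<Longrightarrow> \<not> r * (1/2) ^ Suc m \<le> t"
    using exists_least_iff[of "\<lambda>n. r * (1/2) ^ Suc n \<le> t"] by blast
  \<comment> \<open>For positive \<open>k\<close> this is the minimality of \<open>k\<close>,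
    applied to its predecessor; for \<open>k = 0\<close> it is the assumption
    \<open>t < r\<close>.\<close>
  have "t < r * (1/2) ^ k"
    using k(2)[of "k - 1"] assms by (cases k) auto
  with k(1) show ?thesis by (rule that)
qed

text \<open>Dyadic shells: by the slab bound the shell of radius about \<open>2\<^sup>-\<^sup>k r\<close> contributes \<open>O (2\<^sup>-\<^sup>k r)\<close>.\<close>

lemma nn_integral_flat_le:
  fixes q :: "'a::euclidean_space"
  assumes q: "1/2 \<le> norm q" and C: "0 < C" and r: "0 < r"
  shows "(\<integral>\<^sup>+z. ennreal (indicator (ball 0 r \<inter> {z. \<bar>q \<bullet> z\<bar> \<le> C * (norm z)\<^sup>2}) z / norm z ^ DIM('a)) \<partial>lborel)
           \<le> ennreal (10 * 4 ^ DIM('a) * measure lborel (ball (0::'a) 1) * C * r)"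
proof -
  let ?d = "DIM('a)"
  define w where "w = measure lborel (ball (0::'a) 1)"
  have w: "0 \<le> w" by (simp add: w_def)
  define \<rho> where "\<rho> k = r * (1/2) ^ k" for k
  have \<rho>: "0 < \<rho> k" "\<rho> (Suc k) = \<rho> k / 2" for k using r by (auto simp: \<rho>_def)
  \<comment> \<open>\<open>D k\<close> is a flat slab: on the shell of radii between
    \<open>\<rho> (Suc k)\<close> and \<open>\<rho> k\<close> the quadratic bound
    \<open>C * (norm z)\<^sup>2\<close> is at most the constant
    \<open>C * (\<rho> k)\<^sup>2\<close>.\<close>
  define D where "D k = cball (0::'a) (\<rho> k) \<inter> {z. \<bar>q \<bullet> z\<bar> \<le> C * (\<rho> k)\<^sup>2}" for k
  have D_closed: "closed (D k)" for k
    unfolding D_def by (intro closed_Int closed_cball closed_Collect_le continuous_intros)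
  then have [measurable]: "D k \<in> sets borel" for k by (rule borel_closed)
  have D_fin: "emeasure lborel (D k) = ennreal (measure lborel (D k))" for k
    using emeasure_mono[of "D k" "cball 0 (\<rho> k)" lborel] emeasure_lborel_cball_finite[of "0::'a" "\<rho> k"]
    by (intro emeasure_eq_ennreal_measure) (auto simp: D_def top_unique)
  have "(\<integral>\<^sup>+z. ennreal (indicator (ball 0 r \<inter> {z. \<bar>q \<bullet> z\<bar> \<le> C * (norm z)\<^sup>2}) z / norm z ^ ?d) \<partial>lborel)
     \<le> (\<integral>\<^sup>+z. (\<Sum>k. ennreal (1 / \<rho> (Suc k) ^ ?d) * indicator (D k) z) \<partial>lborel)"
  proof (rule nn_integral_mono)
    fix z :: 'a
    show "ennreal (indicator (ball 0 r \<inter> {z. \<bar>q \<bullet> z\<bar> \<le> C * (norm z)\<^sup>2}) z / norm z ^ ?d)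
      \<le> (\<Sum>k. ennreal (1 / \<rho> (Suc k) ^ ?d) * indicator (D k) z)"
    \<comment> \<open>At the origin the integrand is \<open>0\<close>, division by zero giving
      \<open>0\<close>, so only nonzero points have to be placed in a shell.\<close>
    proof (cases "z \<noteq> 0 \<and> norm z < r \<and> \<bar>q \<bullet> z\<bar> \<le> C * (norm z)\<^sup>2")
      case True
      then obtain k where k: "\<rho> (Suc k) \<le> norm z" "norm z < \<rho> k"
        using dyadic_scale[of "norm z" r] unfolding \<rho>_def by auto
      have "C * (norm z)\<^sup>2 \<le> C * (\<rho> k)\<^sup>2"
        using k C by (intro mult_left_mono power_mono) auto
      then have zD: "z \<in> D k" using True k by (auto simp: D_def)
      have "ennreal (1 / norm z ^ ?d) \<le> ennreal (1 / \<rho> (Suc k) ^ ?d)"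
        using k True \<rho>(1)[of "Suc k"]
        by (intro ennreal_leI divide_left_mono power_mono mult_pos_pos zero_less_power) auto
      also have "\<dots> = (\<Sum>k\<in>{k}. ennreal (1 / \<rho> (Suc k) ^ ?d) * indicator (D k) z)"
        using zD by simp
      also have "\<dots> \<le> (\<Sum>k. ennreal (1 / \<rho> (Suc k) ^ ?d) * indicator (D k) z)"
        by (rule sum_le_suminf) auto
      finally show ?thesis using True by simp
    qed (auto simp: power_0_left split: split_indicator)
  qed
  also have "\<dots> = (\<Sum>k. ennreal (1 / \<rho> (Suc k) ^ ?d) * emeasure lborel (D k))"
    by (simp add: nn_integral_suminf nn_integral_cmult)
  also have "\<dots> \<le> (\<Sum>k. ennreal (5 * 4 ^ ?d * w * C * r * (1/2) ^ k))"
  proof (rule suminf_le)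
    fix k
    have "measure lborel (D k) \<le> 5 * (C * (\<rho> k)\<^sup>2) / \<rho> k * ((2 * \<rho> k) ^ ?d * w)"
      unfolding D_def w_def using C \<rho>(1)[of k] by (intro measure_slab_le q) auto
    \<comment> \<open>As \<open>2 * \<rho> k = 4 * \<rho> (Suc k)\<close>, the volume carries the
      factor \<open>\<rho> (Suc k) ^ d\<close>, which cancels against the kernel. One factor
      \<open>\<rho> k\<close> is left over and makes the series geometric.\<close>
    also have "\<dots> = 5 * 4 ^ ?d * w * C * \<rho> k * \<rho> (Suc k) ^ ?d"
    proof -
      have "(4::real) ^ ?d = 2 ^ ?d * 2 ^ ?d" by (simp flip: power_mult_distrib)
      then show ?thesis
        using \<rho>(1)[of k] by (simp add: \<rho>(2) power_divide power_mult_distrib power2_eq_square)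
    qed
    finally have "1 / \<rho> (Suc k) ^ ?d * measure lborel (D k) \<le> 5 * 4 ^ ?d * w * C * r * (1/2) ^ k"
      using \<rho>(1)[of "Suc k"] by (simp add: divide_le_eq \<rho>_def mult.assoc)
    then show "ennreal (1 / \<rho> (Suc k) ^ ?d) * emeasure lborel (D k) \<le> ennreal (5 * 4 ^ ?d * w * C * r * (1/2) ^ k)"
      unfolding D_fin using \<rho>(1)[of "Suc k"] by (subst ennreal_mult[symmetric]) (auto intro!: ennreal_leI)
  qed auto
  also have "\<dots> = ennreal (5 * 4 ^ ?d * w * C * r * 2)"
  proof (rule suminf_ennreal_eq)
    show "(\<lambda>k. 5 * 4 ^ ?d * w * C * r * (1/2) ^ k) sums (5 * 4 ^ ?d * w * C * r * 2)"
      using geometric_sums[of "1/2::real"] by (intro sums_mult) simp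
  qed (use w C r in auto)
  finally show ?thesis by (simp add: w_def mult_ac)
qed

text \<open>This holds if near \<open>x\<close> the set \<open>A\<close> is the half-space normal to \<open>q\<close> up to an error quadratic in the
  distance to \<open>x\<close>; only the antisymmetry under the point reflection at \<open>x\<close> matters.\<close>

definition nearly_halfspace :: "real \<Rightarrow> real \<Rightarrow> 'a::euclidean_space \<Rightarrow> 'a set \<Rightarrow> bool" where
  "nearly_halfspace C \<delta> x A \<longleftrightarrow>
     (\<exists>q. 1/2 \<le> norm q \<and>
       (\<forall>z. norm z < \<delta> \<longrightarrow> C * (norm z)\<^sup>2 < \<bar>q \<bullet> z\<bar> \<longrightarrow> (x + z \<in> A \<longleftrightarrow> x - z \<notin> A)))"

lemma nearly_halfspace_Compl: "nearly_halfspace C \<delta> x (- A) \<longleftrightarrow> nearly_halfspace C \<delta> x A"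
  unfolding nearly_halfspace_def by auto

text \<open>The integral is half that of the integrand plus its reflection at \<open>x\<close>. This
  sum vanishes wherever the set is antisymmetric; elsewhere it is at most
  \<open>2 / norm (x - y) ^ d\<close>, because \<open>p \<le> d\<close> and the distances are below
  \<open>1\<close>. The bound depends neither on \<open>p\<close> nor on the inner radius
  \<open>r'\<close>, which makes it uniform along the sequence of exponents.\<close>

lemma annulus_integral_le:
  fixes x :: "'a::euclidean_space"
  assumes A[measurable]: "A \<in> sets borel" and fl: "nearly_halfspace C \<delta> x A" and C: "0 < C"
    and r: "0 < r" "r \<le> \<delta>" "r \<le> 1" and p: "p \<le> real DIM('a)"
    and int: "set_integrable lborel (ball x r - ball x r')
       (\<lambda>y. (indicator (- A) y - indicator A y) / norm (x - y) powr p)"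
  shows "\<bar>LINT y:ball x r - ball x r'|lborel. (indicator (- A) y - indicator A y) / norm (x - y) powr p\<bar>
     \<le> 10 * 4 ^ DIM('a) * measure lborel (ball (0::'a) 1) * C * r"
proof -
  obtain q where q: "1/2 \<le> norm q"
    "\<And>z. norm z < \<delta> \<Longrightarrow> C * (norm z)\<^sup>2 < \<bar>q \<bullet> z\<bar> \<Longrightarrow> x + z \<in> A \<longleftrightarrow> x - z \<notin> A"
    using fl by (auto simp: nearly_halfspace_def)
  let ?S = "ball x r - ball x r'"
  define \<sigma> where "\<sigma> y = (indicator (- A) y - indicator A y :: real)" for y
  have [measurable]: "\<sigma> \<in> borel_measurable borel" unfolding \<sigma>_def by measurable
  define f where "f y = indicator ?S y * (\<sigma> y / norm (x - y) powr p)" for y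
  have [measurable]: "ball c t \<in> sets borel" for c :: 'a and t by simp
  have [measurable]: "f \<in> borel_measurable borel" unfolding f_def by measurable
  have f: "integrable lborel f"
    using int by (simp add: f_def[abs_def] \<sigma>_def set_integrable_def)
  have f2: "integrable lborel (\<lambda>y. f (2 *\<^sub>R x - y))" "integral\<^sup>L lborel (\<lambda>y. f (2 *\<^sub>R x - y)) = integral\<^sup>L lborel f"
  proof -
    have "integrable (distr lborel borel (\<lambda>y. 2 *\<^sub>R x - y)) f" using f by (simp add: distr_lborel_reflect)
    then show "integrable lborel (\<lambda>y. f (2 *\<^sub>R x - y))" by (subst (asm) integrable_distr_eq) auto
    have "integral\<^sup>L lborel f = integral\<^sup>L (distr lborel borel (\<lambda>y. 2 *\<^sub>R x - y)) f"
      by (simp add: distr_lborel_reflect)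
    then show "integral\<^sup>L lborel (\<lambda>y. f (2 *\<^sub>R x - y)) = integral\<^sup>L lborel f"
      by (simp add: integral_distr)
  qed
  let ?B = "ball 0 r \<inter> {z. \<bar>q \<bullet> z\<bar> \<le> C * (norm z)\<^sup>2}"
  let ?K = "10 * 4 ^ DIM('a) * measure lborel (ball (0::'a) 1) * C * r"
  \<comment> \<open>Outside \<open>?B\<close> the two values of \<open>\<sigma>\<close> are
    opposite. At \<open>y = x\<close> both sides are \<open>0\<close> by the convention on division
    by zero.\<close>
  have pw: "norm (f y + f (2 *\<^sub>R x - y)) \<le> 2 * (indicator ?B (x - y) / norm (x - y) ^ DIM('a))" for y
  proof (cases "y \<in> ?S \<and> y \<noteq> x")
    case True
    then have yr: "norm (y - x) < r" by (auto simp: dist_norm norm_minus_commute)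
    have refl: "2 *\<^sub>R x - y \<in> ?S" "norm (x - (2 *\<^sub>R x - y)) = norm (x - y)"
      using True by (auto simp: dist_norm norm_minus_commute scaleR_2 algebra_simps)
    have eq: "f y + f (2 *\<^sub>R x - y) = (\<sigma> y + \<sigma> (2 *\<^sub>R x - y)) / norm (x - y) powr p"
      using True refl by (simp add: f_def add_divide_distrib)
    show ?thesis
    proof (cases "C * (norm (y - x))\<^sup>2 < \<bar>q \<bullet> (y - x)\<bar>")
      case True
      then have "y \<in> A \<longleftrightarrow> 2 *\<^sub>R x - y \<notin> A"
        using q(2)[of "y - x"] yr r by (simp add: scaleR_2 algebra_simps)
      then have "\<sigma> y + \<sigma> (2 *\<^sub>R x - y) = 0" by (auto simp: \<sigma>_def split: split_indicator)
      then show ?thesis using eq by simp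
    next
      case False
      then have "x - y \<in> ?B" using yr by (auto simp: norm_minus_commute inner_diff_right abs_minus_commute)
      moreover have "\<bar>\<sigma> y + \<sigma> (2 *\<^sub>R x - y)\<bar> \<le> 2" by (auto simp: \<sigma>_def split: split_indicator)
      moreover have "norm (x - y) ^ DIM('a) \<le> norm (x - y) powr p"
        using powr_mono'[OF p, of "norm (x - y)"] yr r
        by (simp add: powr_realpow' norm_minus_commute)
      moreover have "norm (x - y) ^ DIM('a) > 0" by (rule zero_less_power) (use True in auto)
      ultimately show ?thesis
        unfolding eq by (auto simp: abs_mult intro!: frac_le)
    qed
  next
    case False
    have "norm (x - (2 *\<^sub>R x - y)) = norm (x - y)" by (simp add: norm_minus_commute scaleR_2 algebra_simps)
    then have "f y = 0 \<and> f (2 *\<^sub>R x - y) = 0"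
      using False by (auto simp: f_def dist_norm split: split_indicator)
    then show ?thesis by simp
  qed
  have "ennreal (norm (integral\<^sup>L lborel (\<lambda>y. f y + f (2 *\<^sub>R x - y)))) \<le> (\<integral>\<^sup>+y. norm (f y + f (2 *\<^sub>R x - y)) \<partial>lborel)"
    using f f2 by (intro integral_norm_bound_ennreal) auto
  also have "\<dots> \<le> (\<integral>\<^sup>+y. 2 * ennreal (indicator ?B (x - y) / norm (x - y) ^ DIM('a)) \<partial>lborel)"
    using pw by (intro nn_integral_mono) (auto simp: ennreal_mult'[symmetric] simp flip: ennreal_numeral intro!: ennreal_leI)
  also have "\<dots> = 2 * (\<integral>\<^sup>+y. ennreal (indicator ?B (x - y) / norm (x - y) ^ DIM('a)) \<partial>lborel)"
    by (intro nn_integral_cmult) measurable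
  also have "(\<integral>\<^sup>+y. ennreal (indicator ?B (x - y) / norm (x - y) ^ DIM('a)) \<partial>lborel)
      = (\<integral>\<^sup>+z. ennreal (indicator ?B z / norm z ^ DIM('a)) \<partial>lborel)"
    by (rule nn_integral_lborel_reflect[of "\<lambda>z. ennreal (indicator ?B z / norm z ^ DIM('a))"]) measurable
  also have "2 * \<dots> \<le> 2 * ennreal ?K"
    by (intro mult_left_mono nn_integral_flat_le q C r) auto
  also have "\<dots> = ennreal (2 * ?K)"
    by (simp only: ennreal_mult'' ennreal_numeral[symmetric] ennreal_mult'[symmetric] zero_le_numeral)
  finally have "norm (integral\<^sup>L lborel (\<lambda>y. f y + f (2 *\<^sub>R x - y))) \<le> 2 * ?K"
    using C r by (subst (asm) ennreal_le_iff) auto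
  moreover have "integral\<^sup>L lborel (\<lambda>y. f y + f (2 *\<^sub>R x - y)) = 2 * integral\<^sup>L lborel f"
    using f f2 by simp
  ultimately have "\<bar>integral\<^sup>L lborel f\<bar> \<le> ?K" by (simp add: mult_ac)
  then show ?thesis by (simp add: f_def[abs_def] \<sigma>_def set_lebesgue_integral_def)
qed

section \<open>Powers of the distance on balls and annuli\<close>

lemma d_omega_pos: "0 < d_omega TYPE('a::euclidean_space)"
  by (simp add: d_omega_def)

text \<open>In polar coordinates this is \<open>d_omega\<close> times the integral of
  \<open>t powr (- s - 1)\<close> over \<open>{0..R}\<close>, which is finite because
  \<open>s < 0\<close>. Its pole at \<open>s = 0\<close> is the origin of the term
  \<open>d_omega / s\<close> in the theorem.\<close>

lemma has_bochner_integral_ball_norm_powr: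
  fixes x :: "'a::euclidean_space" and s :: real
  assumes s: "s < 0" and R: "0 < R"
  shows "has_bochner_integral lborel (\<lambda>y. indicator (ball x R) y *\<^sub>R (1 / norm (x - y) powr (DIM('a) + s)))
     (d_omega TYPE('a) * R powr (- s) / (- s))"
proof (rule has_bochner_integral_nn_integral)
  define f where "f t = ennreal (indicator {..<R} t / t powr (DIM('a) + s))" for t :: real
  have [measurable]: "f \<in> borel_measurable borel" unfolding f_def by measurable
  have "(\<integral>\<^sup>+y. ennreal (indicator (ball x R) y *\<^sub>R (1 / norm (x - y) powr (DIM('a) + s))) \<partial>lborel)
     = (\<integral>\<^sup>+y. f (norm (x - y)) \<partial>lborel)"
    by (intro nn_integral_cong) (auto simp: f_def dist_norm split: split_indicator)
  also have "\<dots> = (\<integral>\<^sup>+t. ennreal (d_omega TYPE('a) * t ^ (DIM('a) - 1)) * indicator {0..} t * f t \<partial>lborel)"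
    by (rule nn_integral_lborel_norm) measurable
  also have "\<dots> = (\<integral>\<^sup>+t. ennreal (d_omega TYPE('a) * t powr (- s - 1)) * indicator {0..R} t \<partial>lborel)"
  proof (rule nn_integral_cong_AE)
    show "AE t in lborel. ennreal (d_omega TYPE('a) * t ^ (DIM('a) - 1)) * indicator {0..} t * f t
      = ennreal (d_omega TYPE('a) * t powr (- s - 1)) * indicator {0..R} t"
      using AE_lborel_singleton[of 0] AE_lborel_singleton[of R]
    proof eventually_elim
      case (elim t)
      show ?case
      proof (cases "0 < t \<and> t < R")
        case True
        have "t ^ (DIM('a) - 1) / t powr (DIM('a) + s) = t powr real (DIM('a) - 1) / t powr (DIM('a) + s)"
          by (subst powr_realpow) (use True in auto)
        also have "\<dots> = t powr (real (DIM('a) - 1) - (DIM('a) + s))"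
          by (rule powr_diff[symmetric])
        also have "real (DIM('a) - 1) - (DIM('a) + s) = - s - 1"
          by (simp add: of_nat_diff Suc_leI)
        finally have "d_omega TYPE('a) * (t ^ (DIM('a) - 1) / t powr (DIM('a) + s)) = d_omega TYPE('a) * t powr (- s - 1)"
          by (rule arg_cong)
        then show ?thesis
          using True d_omega_pos[where 'a='a] by (simp add: f_def flip: ennreal_mult')
      qed (use elim in \<open>auto simp: f_def split: split_indicator\<close>)
    qed
  qed
  also have "\<dots> = ennreal (d_omega TYPE('a) * R powr (- s) / (- s))"
  proof (rule nn_integral_has_integral_lebesgue')
    have "((\<lambda>t. d_omega TYPE('a) * t powr (- s - 1)) has_integral
      d_omega TYPE('a) * (R powr (- s - 1 + 1) / (- s - 1 + 1))) {0..R}"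
      using s R by (intro has_integral_mult_right has_integral_powr_from_0) auto
    then show "((\<lambda>t. d_omega TYPE('a) * t powr (- s - 1)) has_integral
      d_omega TYPE('a) * R powr (- s) / (- s)) {0..R}" by simp
  qed (use d_omega_pos[where 'a='a] in auto)
  finally show "(\<integral>\<^sup>+y. ennreal (indicator (ball x R) y *\<^sub>R (1 / norm (x - y) powr (DIM('a) + s))) \<partial>lborel)
     = ennreal (d_omega TYPE('a) * R powr (- s) / (- s))" .
  have [measurable]: "ball c t \<in> sets borel" for c :: 'a and t by simp
  show "(\<lambda>y. indicator (ball x R) y *\<^sub>R (1 / norm (x - y) powr (DIM('a) + s))) \<in> borel_measurable lborel"
    by measurable
qed (use s d_omega_pos[where 'a='a] in \<open>auto simp: divide_nonneg_neg\<close>)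

lemma has_bochner_integral_annulus_norm:
  fixes x :: "'a::euclidean_space"
  assumes r: "0 < r" "r \<le> R"
  shows "has_bochner_integral lborel (\<lambda>y. indicator (ball x R - ball x r) y *\<^sub>R (1 / norm (x - y) ^ DIM('a)))
     (d_omega TYPE('a) * (ln R - ln r))"
proof (rule has_bochner_integral_nn_integral)
  define f where "f t = ennreal (indicator {r..<R} t / t ^ DIM('a))" for t :: real
  have [measurable]: "f \<in> borel_measurable borel" unfolding f_def by measurable
  have "(\<integral>\<^sup>+y. ennreal (indicator (ball x R - ball x r) y *\<^sub>R (1 / norm (x - y) ^ DIM('a))) \<partial>lborel)
     = (\<integral>\<^sup>+y. f (norm (x - y)) \<partial>lborel)"
    by (intro nn_integral_cong) (auto simp: f_def dist_norm split: split_indicator)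
  also have "\<dots> = (\<integral>\<^sup>+t. ennreal (d_omega TYPE('a) * t ^ (DIM('a) - 1)) * indicator {0..} t * f t \<partial>lborel)"
    by (rule nn_integral_lborel_norm) measurable
  also have "\<dots> = (\<integral>\<^sup>+t. ennreal (d_omega TYPE('a) / t) * indicator {r..R} t \<partial>lborel)"
  proof (rule nn_integral_cong_AE)
    show "AE t in lborel. ennreal (d_omega TYPE('a) * t ^ (DIM('a) - 1)) * indicator {0..} t * f t
      = ennreal (d_omega TYPE('a) / t) * indicator {r..R} t"
      using AE_lborel_singleton[of R]
    proof eventually_elim
      case (elim t)
      show ?case
      proof (cases "r \<le> t \<and> t < R")
        case True
        have "d_omega TYPE('a) * t ^ (DIM('a) - 1) / (t * t ^ (DIM('a) - 1)) = d_omega TYPE('a) / t"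
          using True r by simp
        then have "d_omega TYPE('a) * t ^ (DIM('a) - 1) / t ^ DIM('a) = d_omega TYPE('a) / t"
          using power_Suc[of t "DIM('a) - 1"] by simp
        then show ?thesis
          using True r d_omega_pos[where 'a='a] by (simp add: f_def flip: ennreal_mult')
      qed (use elim r in \<open>auto simp: f_def split: split_indicator\<close>)
    qed
  qed
  also have "\<dots> = ennreal (d_omega TYPE('a) * ln R - d_omega TYPE('a) * ln r)"
    by (rule nn_integral_FTC_Icc)
       (use r d_omega_pos[where 'a='a] in \<open>auto intro!: derivative_eq_intros\<close>)
  finally show "(\<integral>\<^sup>+y. ennreal (indicator (ball x R - ball x r) y *\<^sub>R (1 / norm (x - y) ^ DIM('a))) \<partial>lborel)
     = ennreal (d_omega TYPE('a) * (ln R - ln r))" by (simp add: right_diff_distrib)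
  have [measurable]: "ball c t \<in> sets borel" for c :: 'a and t by simp
  show "(\<lambda>y. indicator (ball x R - ball x r) y *\<^sub>R (1 / norm (x - y) ^ DIM('a))) \<in> borel_measurable lborel"
    by measurable
qed (use r d_omega_pos[where 'a='a] in auto)

lemma set_integrable_kernel_ball:
  fixes x :: "'a::euclidean_space" and s :: real
  assumes [measurable]: "A \<in> sets borel" and s: "s < 0" and R: "0 < R"
  shows "set_integrable lborel (ball x R) (\<lambda>y. (indicator (- A) y - indicator A y) / norm (x - y) powr (DIM('a) + s))"
  unfolding set_integrable_def
proof (rule Bochner_Integration.integrable_bound)
  show "integrable lborel (\<lambda>y. indicator (ball x R) y *\<^sub>R (1 / norm (x - y) powr (DIM('a) + s)))"
    using has_bochner_integral_ball_norm_powr[OF s R] by (rule integrable.intros)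
  have [measurable]: "ball c t \<in> sets borel" for c :: 'a and t by simp
  show "(\<lambda>y. indicator (ball x R) y *\<^sub>R ((indicator (- A) y - indicator A y) / norm (x - y) powr (DIM('a) + s)))
    \<in> borel_measurable lborel" by measurable
qed (auto split: split_indicator)

lemma set_integrable_kernel_annulus:
  fixes x :: "'a::euclidean_space"
  assumes [measurable]: "A \<in> sets borel" and r: "0 < r"
  shows "set_integrable lborel (ball x R - ball x r) (\<lambda>y. (indicator (- A) y - indicator A y) / norm (x - y) ^ DIM('a))"
  unfolding set_integrable_def
proof (rule Bochner_Integration.integrable_bound)
  \<comment> \<open>Taking \<open>max r R\<close> as the outer radius also covers
    \<open>R < r\<close>, where the annulus is empty.\<close>
  have "integrable lborel (\<lambda>y. indicator (ball x (max r R) - ball x r) y *\<^sub>R (1 / norm (x - y) ^ DIM('a)))"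
    using has_bochner_integral_annulus_norm[OF r, of "max r R"] by (rule integrable.intros) simp
  then show "integrable lborel (\<lambda>y. indicator (ball x (max r R) - ball x r) y *\<^sub>R (1 / norm (x - y) ^ DIM('a)))" .
  have [measurable]: "ball c t \<in> sets borel" for c :: 'a and t by simp
  show "(\<lambda>y. indicator (ball x R - ball x r) y *\<^sub>R ((indicator (- A) y - indicator A y) / norm (x - y) ^ DIM('a)))
    \<in> borel_measurable lborel" by measurable
qed (auto split: split_indicator)

text \<open>Dominated convergence. For \<open>r \<le> t\<close> and \<open>0 \<le> p \<le> d\<close>
  the power \<open>t powr p\<close> is at least \<open>1\<close> if \<open>1 \<le> t\<close> and at
  least \<open>r ^ d\<close> otherwise, which gives a constant majorant on the ball. Almost every
  point lies eventually in all or in none of the sets, as it does for the limit.\<close>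

lemma tendsto_annulus_integral:
  fixes x :: "'a::euclidean_space"
  assumes A[measurable]: "A \<in> sets borel" "\<And>n. An n \<in> sets borel" and r: "0 < r"
    and ae: "AE y in lborel. \<forall>\<^sub>F n in sequentially. y \<in> An n \<longleftrightarrow> y \<in> A"
    and p: "p \<longlonglongrightarrow> real DIM('a)" "\<And>n. 0 \<le> p n" "\<And>n. p n \<le> real DIM('a)"
  shows "(\<lambda>n. LINT y:ball x R - ball x r|lborel. (indicator (- An n) y - indicator (An n) y) / norm (x - y) powr p n)
     \<longlonglongrightarrow> annular_integral x A R r"
  unfolding annular_integral_def set_lebesgue_integral_def
proof (rule integral_dominated_convergence[where w="\<lambda>y. indicator (ball x R) y *\<^sub>R (1 / min 1 (r ^ DIM('a)))"])
  have [measurable]: "ball c t \<in> sets borel" for c :: 'a and t by simp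
  show "(\<lambda>y. indicator (ball x R - ball x r) y *\<^sub>R ((indicator (- A) y - indicator A y) / norm (x - y) ^ DIM('a)))
    \<in> borel_measurable lborel" by measurable
  show "(\<lambda>y. indicator (ball x R - ball x r) y *\<^sub>R ((indicator (- An n) y - indicator (An n) y) / norm (x - y) powr p n))
    \<in> borel_measurable lborel" for n by measurable
  show "integrable lborel (\<lambda>y. indicator (ball x R) y *\<^sub>R (1 / min 1 (r ^ DIM('a))))"
    by (intro integrable_scaleR_left integrable_real_indicator) (use emeasure_lborel_ball_finite[of x R] in auto)
  show "AE y in lborel. norm (indicator (ball x R - ball x r) y *\<^sub>R
     ((indicator (- An n) y - indicator (An n) y) / norm (x - y) powr p n))
     \<le> indicator (ball x R) y *\<^sub>R (1 / min 1 (r ^ DIM('a)))" for n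
  proof (rule AE_I2)
    fix y
    show "norm (indicator (ball x R - ball x r) y *\<^sub>R
       ((indicator (- An n) y - indicator (An n) y) / norm (x - y) powr p n))
       \<le> indicator (ball x R) y *\<^sub>R (1 / min 1 (r ^ DIM('a)))"
    proof (cases "y \<in> ball x R - ball x r")
      case True
      define t where "t = norm (x - y)"
      have t: "r \<le> t" using True by (auto simp: t_def dist_norm)
      have "min 1 (r ^ DIM('a)) \<le> t powr p n"
      proof (cases "1 \<le> t")
        case True
        then show ?thesis using p(2)[of n] ge_one_powr_ge_zero[of t "p n"] by simp
      next
        case False
        have "r ^ DIM('a) \<le> t ^ DIM('a)" using t r by (intro power_mono) auto
        also have "\<dots> = t powr DIM('a)" using t r by (simp add: powr_realpow)
        also have "\<dots> \<le> t powr p n" using False t r p(3) by (intro powr_mono') auto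
        finally show ?thesis by simp
      qed
      then show ?thesis using True r
        by (auto simp: t_def abs_mult intro!: frac_le split: split_indicator)
    qed (use r in \<open>auto split: split_indicator\<close>)
  qed
  show "AE y in lborel. (\<lambda>n. indicator (ball x R - ball x r) y *\<^sub>R
     ((indicator (- An n) y - indicator (An n) y) / norm (x - y) powr p n))
     \<longlonglongrightarrow> indicator (ball x R - ball x r) y *\<^sub>R ((indicator (- A) y - indicator A y) / norm (x - y) ^ DIM('a))"
    using ae
  proof eventually_elim
    case (elim y)
    show ?case
    proof (cases "y \<in> ball x R - ball x r")
      case True
      then have pos: "0 < norm (x - y)" using r by (auto simp: dist_norm)
      have "(\<lambda>n. (indicator (- A) y - indicator A y) / norm (x - y) powr p n)
        \<longlonglongrightarrow> (indicator (- A) y - indicator A y) / norm (x - y) powr DIM('a)"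
        using pos by (intro tendsto_intros p) auto
      then have "(\<lambda>n. (indicator (- A) y - indicator A y) / norm (x - y) powr p n)
        \<longlonglongrightarrow> (indicator (- A) y - indicator A y) / norm (x - y) ^ DIM('a)"
        using pos by (simp add: powr_realpow)
      then have "(\<lambda>n. (indicator (- An n) y - indicator (An n) y) / norm (x - y) powr p n)
        \<longlonglongrightarrow> (indicator (- A) y - indicator A y) / norm (x - y) ^ DIM('a)"
        by (rule Lim_transform_eventually) (use elim in eventually_elim, auto simp: indicator_def)
      then show ?thesis by (intro tendsto_scaleR tendsto_const)
    qed simp
  qed
qed

section \<open>The Riesz potential as the exponent tends to the dimension\<close>

lemma annular_integral_cong_powr:
  "annular_integral x A R r =
     (LINT y:ball x R - ball x r|lborel. (indicator (- A) y - indicator A y) / norm (x - y) powr real DIM('a))"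
  for x :: "'a::euclidean_space"
  by (simp add: annular_integral_def powr_realpow')

lemma annular_integral_diff:
  fixes x :: "'a::euclidean_space"
  assumes A: "A \<in> sets borel" and r: "0 < r'" "r' \<le> r" "r \<le> R"
  shows "annular_integral x A R r' - annular_integral x A R r = annular_integral x A r r'"
proof -
  have "ball x R - ball x r' = (ball x R - ball x r) \<union> (ball x r - ball x r')"
    using subset_ball[OF r(2), of x] subset_ball[OF r(3), of x] by blast
  moreover have "annular_integral x A R r + annular_integral x A r r' =
     (LINT y:(ball x R - ball x r) \<union> (ball x r - ball x r')|lborel.
        (indicator (- A) y - indicator A y) / norm (x - y) ^ DIM('a))"
    unfolding annular_integral_def
    by (subst set_integral_Un) (use A r in \<open>auto intro!: set_integrable_kernel_annulus\<close>)
  ultimately show ?thesis by (simp add: annular_integral_def)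
qed

lemma annular_integral_small:
  fixes x :: "'a::euclidean_space"
  assumes "A \<in> sets borel" "nearly_halfspace C \<delta> x A" "0 < C" "0 < r" "r \<le> \<delta>" "r \<le> 1" "0 < r'"
  shows "\<bar>annular_integral x A r r'\<bar> \<le> 10 * 4 ^ DIM('a) * measure lborel (ball (0::'a) 1) * C * r"
  unfolding annular_integral_cong_powr
  by (rule annulus_integral_le)
     (use assms set_integrable_kernel_annulus[of A r' x r] in \<open>auto simp: powr_realpow'\<close>)

text \<open>Existence of the principal value. Shrinking the inner radius from \<open>r\<close> to
  \<open>r'\<close> changes the integral by the integral over the annulus in between, which is
  \<open>O(r)\<close> by the reflection argument. The values are therefore Cauchy, and the rate
  survives in the limit.\<close>

lemma annular_integral_convergent:
  fixes x :: "'a::euclidean_space"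
  assumes A: "A \<in> sets borel" and fl: "nearly_halfspace C \<delta> x A" and C: "0 < C" and \<delta>: "0 < \<delta>" and R: "0 < R"
  obtains L where "(annular_integral x A R \<longlongrightarrow> L) (at_right 0)"
    "\<And>r. 0 < r \<Longrightarrow> r \<le> \<delta> \<Longrightarrow> r \<le> 1 \<Longrightarrow> r \<le> R \<Longrightarrow>
      \<bar>L - annular_integral x A R r\<bar> \<le> 10 * 4 ^ DIM('a) * measure lborel (ball (0::'a) 1) * C * r"
proof -
  define c where "c = 10 * 4 ^ DIM('a) * measure lborel (ball (0::'a) 1) * C"
  have c: "0 \<le> c" using C by (simp add: c_def)
  have bound: "\<bar>annular_integral x A R r' - annular_integral x A R r\<bar> \<le> c * r"
    if "0 < r'" "r' \<le> r" "r \<le> \<delta>" "r \<le> 1" "r \<le> R" for r r'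
    using annular_integral_diff[OF A, of r' r R x] annular_integral_small[OF A fl C, of r r'] that by (simp add: c_def)
  define r0 where "r0 = min 1 (min \<delta> R)"
  have r0: "0 < r0" "r0 \<le> \<delta>" "r0 \<le> 1" "r0 \<le> R" using \<delta> R by (auto simp: r0_def)
  \<comment> \<open>The limit is found along one sequence of radii; the rate \<open>LB\<close> then
    carries it over to all radii tending to \<open>0\<close>.\<close>
  define X where "X n = annular_integral x A R (r0 / real (Suc n))" for n
  have "Cauchy X"
  proof (rule CauchyI')
    fix e :: real assume e: "0 < e"
    obtain N where N: "c * r0 / e < real N" using reals_Archimedean2 by blast
    have "dist (X m) (X n) < e" if mn: "N \<le> m" "m < n" for m n
    proof -
      have "r0 / real (Suc m) \<le> r0 / 1" "r0 / real (Suc n) \<le> r0 / real (Suc m)"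
        using mn r0(1) by (intro divide_left_mono; simp)+
      then have "dist (X m) (X n) \<le> c * (r0 / real (Suc m))"
        unfolding X_def dist_real_def using r0
        by (subst abs_minus_commute) (intro bound, auto)
      also have "\<dots> < e"
      proof -
        have "c * r0 / e < real (Suc m)" using N mn by simp
        then show ?thesis using e by (simp add: field_simps)
      qed
      finally show ?thesis .
    qed
    then show "\<exists>M. \<forall>m\<ge>M. \<forall>n>m. dist (X m) (X n) < e" by blast
  qed
  then obtain L where L: "X \<longlonglongrightarrow> L" using Cauchy_convergent_iff convergent_def by blast
  have LB: "\<bar>L - annular_integral x A R r\<bar> \<le> c * r" if r: "0 < r" "r \<le> \<delta>" "r \<le> 1" "r \<le> R" for r
  proof (rule tendsto_upperbound)
    show "(\<lambda>n. \<bar>X n - annular_integral x A R r\<bar>) \<longlonglongrightarrow> \<bar>L - annular_integral x A R r\<bar>"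
      by (intro tendsto_intros L)
    have "(\<lambda>n. r0 * (1 / real (Suc n))) \<longlonglongrightarrow> r0 * 0"
      by (intro tendsto_intros LIMSEQ_Suc[OF lim_1_over_n])
    then have "\<forall>\<^sub>F n in sequentially. r0 / real (Suc n) < r"
      using r(1) by (intro order_tendstoD(2)) auto
    then show "\<forall>\<^sub>F n in sequentially. \<bar>X n - annular_integral x A R r\<bar> \<le> c * r"
      by eventually_elim (use r r0 in \<open>auto simp: X_def intro!: bound\<close>)
  qed simp
  have "(annular_integral x A R \<longlongrightarrow> L) (at_right 0)"
  proof (rule Lim_transform_bound[THEN Lim_null[THEN iffD2]])
    show "((\<lambda>r. c * r) \<longlongrightarrow> 0) (at_right 0)" by (auto intro!: tendsto_eq_intros)
    show "\<forall>\<^sub>F r in at_right 0. norm (annular_integral x A R r - L) \<le> norm (c * r)"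
    proof -
      have "\<forall>\<^sub>F r in at_right 0. 0 < r \<and> r < r0"
        using eventually_at_right_real[OF r0(1)] by eventually_elim auto
      then show ?thesis
      proof eventually_elim
        case (elim r)
        then show ?case using LB[of r] r0 c by (simp add: abs_minus_commute abs_mult)
      qed
    qed
  qed
  then show ?thesis using LB by (intro that) (auto simp: c_def)
qed

text \<open>Beyond a ball containing \<open>A\<close> the integrand is the bare kernel. The
  logarithm obtained is the one that \<open>zero_curvature\<close> compensates, so that its outer
  limit is attained at a finite radius.\<close>

lemma annular_integral_outside:
  fixes x :: "'a::euclidean_space"
  assumes "A \<subseteq> ball x r" "0 < r" "r \<le> R"
  shows "annular_integral x A R r = d_omega TYPE('a) * (ln R - ln r)"
proof -
  have "annular_integral x A R r = (LINT y|lborel. indicator (ball x R - ball x r) y *\<^sub>R (1 / norm (x - y) ^ DIM('a)))"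
    unfolding annular_integral_def set_lebesgue_integral_def
    by (intro Bochner_Integration.integral_cong) (use assms(1) in \<open>auto split: split_indicator\<close>)
  then show ?thesis
    using has_bochner_integral_annulus_norm[OF assms(2,3), of x] by (simp add: has_bochner_integral_integral_eq)
qed

lemma annular_integral_Compl: "annular_integral x (- A) R r = - annular_integral x A R r"
proof -
  have "(indicator A y - indicator (- A) y) / norm (x - y) ^ DIM('a)
      = - ((indicator (- A) y - indicator A y :: real) / norm (x - y) ^ DIM('a))" for y
    by (simp add: minus_divide_left)
  then show ?thesis by (simp add: annular_integral_def set_lebesgue_integral_def)
qed

text \<open>Stated for a bounded set \<open>A\<close>, this serves both for \<open>E\<close> and for
  its complement. The limit is \<open>H = L - d_omega * ln R\<close>, where \<open>L\<close> is the
  principal value over \<open>ball x R\<close>. The second conclusion says that larger radii lead to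
  the same \<open>H\<close>, which identifies it with the curvature.\<close>

lemma riesz_potential_tendsto:
  fixes A :: "'a::euclidean_space set" and x :: 'a
  assumes A: "A \<in> sets borel" "\<And>n. An n \<in> sets borel"
    and R: "0 < R" "A \<subseteq> ball x R" "\<forall>\<^sub>F n in sequentially. An n \<subseteq> ball x R"
    and ae: "AE y in lborel. \<forall>\<^sub>F n in sequentially. y \<in> An n \<longleftrightarrow> y \<in> A"
    and C: "0 < C" and \<delta>: "0 < \<delta>" and flA: "nearly_halfspace C \<delta> x A"
    and flAn: "\<forall>\<^sub>F n in sequentially. nearly_halfspace C \<delta> x (An n)"
    and s: "\<And>n. - real DIM('a) < s n" "\<And>n. s n < 0" "s \<longlonglongrightarrow> 0"
  obtains H where
    "(\<lambda>n. - 2 * (LINT y:An n|lborel. 1 / norm (x - y) powr (real DIM('a) + s n)) - d_omega TYPE('a) / s n) \<longlonglongrightarrow> H"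
    "\<And>R'. R \<le> R' \<Longrightarrow> (annular_integral x A R' \<longlongrightarrow> H + d_omega TYPE('a) * ln R') (at_right 0)"
proof -
  let ?k = "\<lambda>n y. 1 / norm (x - y) powr (real DIM('a) + s n)"
  let ?\<sigma> = "\<lambda>n y. (indicator (- An n) y - indicator (An n) y) / norm (x - y) powr (real DIM('a) + s n)"
  define c where "c = 10 * 4 ^ DIM('a) * measure lborel (ball (0::'a) 1) * C"
  have c: "0 \<le> c" using C by (simp add: c_def)
  obtain L where L: "(annular_integral x A R \<longlongrightarrow> L) (at_right 0)"
    "\<And>r. 0 < r \<Longrightarrow> r \<le> \<delta> \<Longrightarrow> r \<le> 1 \<Longrightarrow> r \<le> R \<Longrightarrow> \<bar>L - annular_integral x A R r\<bar> \<le> c * r"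
    using annular_integral_convergent[OF A(1) flA C \<delta> R(1)] unfolding c_def by blast
  define a where "a n = (LINT y:ball x R|lborel. ?\<sigma> n y)" for n
  have int: "set_integrable lborel (ball x r) (?\<sigma> n)" if "0 < r" for n r
    by (rule set_integrable_kernel_ball) (use A s that in auto)
  have int_sub: "set_integrable lborel (ball x r - ball x r') (?\<sigma> n)" if "0 < r" for n r r'
    by (rule set_integrable_subset[OF int[OF that]]) auto
  have "a \<longlonglongrightarrow> L"
  proof (rule LIMSEQ_I)
    fix e :: real assume e: "0 < e"
    \<comment> \<open>Three errors of at most \<open>e / 4\<close> each are to be added: one on the
      outer annulus, by dominated convergence, and one near \<open>x\<close> for each of the limit
      and the \<open>n\<close>-th integral. The denominator uses \<open>c + 1\<close> since only
      \<open>0 \<le> c\<close> is at hand.\<close>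
    define r where "r = min (min 1 \<delta>) (min R (e / (4 * (c + 1))))"
    have r: "0 < r" "r \<le> 1" "r \<le> \<delta>" "r \<le> R" "r \<le> e / (4 * (c + 1))" using e c \<delta> R by (auto simp: r_def)
    have "c * r \<le> (c + 1) * (e / (4 * (c + 1)))" using r c by (intro mult_mono) auto
    also have "\<dots> = e / 4" using c by (simp add: field_simps)
    finally have cr: "c * r \<le> e / 4" .
    have "(\<lambda>n. LINT y:ball x R - ball x r|lborel. ?\<sigma> n y) \<longlonglongrightarrow> annular_integral x A R r"
    proof (rule tendsto_annulus_integral[OF A r(1) ae])
      show "(\<lambda>n. real DIM('a) + s n) \<longlonglongrightarrow> real DIM('a)"
        using tendsto_add[OF tendsto_const s(3), of "real DIM('a)"] by simp
      show "0 \<le> real DIM('a) + s n" "real DIM('a) + s n \<le> real DIM('a)" for n using s(1,2)[of n] by auto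
    qed
    then have "\<forall>\<^sub>F n in sequentially. dist (LINT y:ball x R - ball x r|lborel. ?\<sigma> n y) (annular_integral x A R r) < e / 4"
      using e by (intro tendstoD) auto
    then have "\<forall>\<^sub>F n in sequentially. norm (a n - L) < e"
      using flAn
    proof eventually_elim
      case (elim n)
      \<comment> \<open>\<open>ball x 0\<close> is empty; writing it lets the whole ball around
        \<open>x\<close> pass for an annulus.\<close>
      have "a n = (LINT y:(ball x R - ball x r) \<union> (ball x r - ball x 0)|lborel. ?\<sigma> n y)"
        unfolding a_def using subset_ball[OF r(4), of x] by (intro arg_cong[where f="\<lambda>S. LINT y:S|lborel. ?\<sigma> n y"]) auto
      also have "\<dots> = (LINT y:ball x R - ball x r|lborel. ?\<sigma> n y) + (LINT y:ball x r - ball x 0|lborel. ?\<sigma> n y)"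
        by (intro set_integral_Un int_sub) (use R r in auto)
      finally have "a n - L = ((LINT y:ball x R - ball x r|lborel. ?\<sigma> n y) - annular_integral x A R r)
         - (L - annular_integral x A R r) + (LINT y:ball x r - ball x 0|lborel. ?\<sigma> n y)" by simp
      moreover have "\<bar>LINT y:ball x r - ball x 0|lborel. ?\<sigma> n y\<bar> \<le> c * r"
        unfolding c_def
        by (rule annulus_integral_le[OF A(2) elim(2) C r(1,3,2) _ int_sub[OF r(1)]]) (use s in \<open>simp add: less_imp_le\<close>)
      ultimately show ?case
        using elim(1) L(2)[OF r(1,3,2,4)] cr e unfolding dist_real_def real_norm_def by linarith
    qed
    then show "\<exists>no. \<forall>n\<ge>no. norm (a n - L) < e" by (simp add: eventually_sequentially)
  qed
  define w where "w = d_omega TYPE('a)"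
  have powr_lim: "(\<lambda>n. (R powr (- s n) - 1) / s n) \<longlonglongrightarrow> - ln R"
  proof -
    have "((\<lambda>h. R powr (- h)) has_real_derivative - ln R) (at 0)"
      using R by (auto intro!: derivative_eq_intros)
    then have "((\<lambda>h. (R powr (- h) - 1) / h) \<longlongrightarrow> - ln R) (at 0)"
      using R by (simp add: DERIV_def)
    moreover have "filterlim s (at 0) sequentially"
      using s(2,3) by (auto simp: filterlim_at less_imp_neq)
    ultimately show ?thesis by (rule filterlim_compose)
  qed
  have eq: "- 2 * (LINT y:An n|lborel. ?k n y) - w / s n = a n + w * ((R powr (- s n) - 1) / s n)"
    if "An n \<subseteq> ball x R" for n
  proof -
    have hb: "has_bochner_integral lborel (\<lambda>y. indicator (ball x R) y *\<^sub>R ?k n y) (w * R powr (- s n) / (- s n))"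
      unfolding w_def by (rule has_bochner_integral_ball_norm_powr) (use s R in auto)
    have i1: "set_integrable lborel (ball x R) (?k n)"
      unfolding set_integrable_def using hb by (rule integrable.intros)
    have i2: "set_integrable lborel (An n) (?k n)"
      by (rule set_integrable_subset[OF i1]) (use A that in auto)
    \<comment> \<open>On the ball, the difference of the indicators of the complement and of
      \<open>An n\<close> is \<open>1\<close> minus twice the latter.\<close>
    have "a n = (LINT y|lborel. indicator (ball x R) y *\<^sub>R ?k n y - 2 * (indicator (An n) y *\<^sub>R ?k n y))"
      unfolding a_def set_lebesgue_integral_def
    proof (intro Bochner_Integration.integral_cong refl)
      fix y
      show "indicator (ball x R) y *\<^sub>R ?\<sigma> n y = indicator (ball x R) y *\<^sub>R ?k n y - 2 * (indicator (An n) y *\<^sub>R ?k n y)"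
        using that by (cases "y \<in> An n"; cases "y \<in> ball x R") auto
    qed
    also have "\<dots> = (LINT y|lborel. indicator (ball x R) y *\<^sub>R ?k n y) - 2 * (LINT y:An n|lborel. ?k n y)"
      using Bochner_Integration.integral_diff[OF i1[unfolded set_integrable_def]
        integrable_mult_right[OF i2[unfolded set_integrable_def], of 2]]
      by (simp only: integral_mult_right_zero set_lebesgue_integral_def)
    also have "(LINT y|lborel. indicator (ball x R) y *\<^sub>R ?k n y) = w * R powr (- s n) / (- s n)"
      using hb by (rule has_bochner_integral_integral_eq)
    finally show ?thesis using s(2)[of n] by (simp add: field_simps)
  qed
  have "(\<lambda>n. a n + w * ((R powr (- s n) - 1) / s n)) \<longlonglongrightarrow> L + w * (- ln R)"
    by (intro tendsto_intros \<open>a \<longlonglongrightarrow> L\<close> powr_lim)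
  then have lim: "(\<lambda>n. - 2 * (LINT y:An n|lborel. ?k n y) - w / s n) \<longlonglongrightarrow> L - w * ln R"
    using Lim_transform_eventually[OF _ eventually_mono[OF R(3) eq[symmetric]]] by simp
  show ?thesis
  proof (rule that[of "L - w * ln R"])
    show "(\<lambda>n. - 2 * (LINT y:An n|lborel. ?k n y) - d_omega TYPE('a) / s n) \<longlonglongrightarrow> L - w * ln R"
      using lim by (simp add: w_def)
    fix R' assume R': "R \<le> R'"
    have "((\<lambda>r. annular_integral x A R r + w * (ln R' - ln R)) \<longlongrightarrow> L + w * (ln R' - ln R)) (at_right 0)"
      by (intro tendsto_intros L)
    moreover have "\<forall>\<^sub>F r in at_right 0. annular_integral x A R r + w * (ln R' - ln R) = annular_integral x A R' r"
      using eventually_at_right_real[OF R(1)]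
    proof eventually_elim
      case (elim r)
      then show ?case
        using annular_integral_diff[OF A(1), of r R R' x] annular_integral_outside[OF R(2,1) R'] R'
        by (simp add: w_def)
    qed
    ultimately have "(annular_integral x A R' \<longlongrightarrow> L + w * (ln R' - ln R)) (at_right 0)"
      by (rule Lim_transform_eventually)
    then show "(annular_integral x A R' \<longlongrightarrow> L - w * ln R + d_omega TYPE('a) * ln R') (at_right 0)"
      by (simp add: w_def algebra_simps)
  qed
qed

section \<open>Local geometry of regular sets\<close>

lemma linear_norm_le_Basis:
  fixes L :: "'a::euclidean_space \<Rightarrow> 'b::real_normed_vector"
  assumes L: "linear L" and B: "\<And>b. b \<in> Basis \<Longrightarrow> norm (L b) \<le> B"
  shows "norm (L v) \<le> real DIM('a) * B * norm v"
proof -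
  have "norm (L v) = norm (L (\<Sum>b\<in>Basis. (v \<bullet> b) *\<^sub>R b))"
    by (simp add: euclidean_representation)
  also have "\<dots> = norm (\<Sum>b\<in>Basis. (v \<bullet> b) *\<^sub>R L b)"
    by (simp add: linear_sum[OF L] linear_scale[OF L])
  also have "\<dots> \<le> (\<Sum>b\<in>(Basis::'a set). norm v * B)"
    by (intro sum_norm_le) (auto intro!: mult_mono B Basis_le_norm)
  finally show ?thesis by (simp add: mult_ac)
qed

text \<open>Second-order Taylor estimate by applying the mean value inequality twice: bounded second
  partial derivatives make the first derivative Lipschitz on the convex set, and linearization along
  the segment from \<open>x\<close> to \<open>y\<close> gives the quadratic error. Each passage from
  basis vectors to arbitrary ones costs a factor \<open>DIM('a)\<close>.\<close>

lemma C2_bounds: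
  fixes f :: "'a::euclidean_space \<Rightarrow> 'b::real_normed_vector"
  assumes S: "convex S"
    and f: "\<And>y. y \<in> S \<Longrightarrow> f differentiable (at y)"
    and Df: "\<And>y b. y \<in> S \<Longrightarrow> b \<in> Basis \<Longrightarrow> iter_deriv [b] f differentiable (at y)"
    and M: "\<And>y b c. y \<in> S \<Longrightarrow> b \<in> Basis \<Longrightarrow> c \<in> Basis \<Longrightarrow> norm (iter_deriv [b, c] f y) \<le> M"
    and x: "x \<in> S" and y: "y \<in> S"
  shows "norm (f y - f x - frechet_derivative f (at x) (y - x)) \<le> real DIM('a) * (real DIM('a) * M) * (norm (y - x))\<^sup>2"
proof -
  let ?d = "real DIM('a)"
  let ?D = "\<lambda>y. frechet_derivative f (at y)"
  have M0: "0 \<le> M" using M[OF x SOME_Basis SOME_Basis] norm_ge_zero order_trans by blast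
  have lin: "linear (?D y)" if "y \<in> S" for y
    using linear_frechet_derivative[OF f[OF that]] .
  have fder: "(f has_derivative ?D y) (at y within T)" if "y \<in> S" for y T
    using f[OF that] frechet_derivative_works has_derivative_at_withinI by blast
  have lip_Basis: "norm (?D z b - ?D x b) \<le> ?d * M * norm (z - x)" if z: "z \<in> S" and b: "b \<in> Basis" for z b
  proof (rule differentiable_bound[OF S _ _ z x])
    fix w assume w: "w \<in> S"
    have d2: "(\<lambda>z. ?D z b) differentiable (at w)" using Df[OF w b] by simp
    then show "((\<lambda>z. ?D z b) has_derivative frechet_derivative (\<lambda>z. ?D z b) (at w)) (at w within S)"
      using frechet_derivative_works has_derivative_at_withinI by blast
    show "onorm (frechet_derivative (\<lambda>z. ?D z b) (at w)) \<le> ?d * M"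
    proof (rule onorm_le)
      fix v
      show "norm (frechet_derivative (\<lambda>z. ?D z b) (at w) v) \<le> ?d * M * norm v"
        by (rule linear_norm_le_Basis[OF linear_frechet_derivative[OF d2]]) (use M[OF w b] in simp)
    qed
  qed
  have lip: "norm (?D z v - ?D x v) \<le> ?d * (?d * M * norm (z - x)) * norm v" if z: "z \<in> S" for z v
    by (rule linear_norm_le_Basis[of "\<lambda>v. ?D z v - ?D x v"])
       (use lip_Basis[OF z] in \<open>auto intro!: linear_compose_sub lin z x\<close>)
  have "norm (f y - f x - ?D x (y - x)) \<le> norm (y - x) * (?d * (?d * M * norm (y - x)))"
  proof (rule differentiable_bound_linearization[where S="closed_segment x y"])
    have seg: "closed_segment x y \<subseteq> S" using x y S by (simp add: closed_segment_subset)
    show "x + t *\<^sub>R (y - x) \<in> closed_segment x y" if "t \<in> {0..1}" for t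
      using that by (auto simp: in_segment algebra_simps)
    show "(f has_derivative ?D z) (at z within closed_segment x y)" if "z \<in> closed_segment x y" for z
      using fder that seg by blast
    show "onorm (?D z - ?D x) \<le> ?d * (?d * M * norm (y - x))" if "z \<in> closed_segment x y" for z
    proof (rule onorm_le)
      fix v
      have "norm ((?D z - ?D x) v) \<le> ?d * (?d * M * norm (z - x)) * norm v"
        using lip[of z v] that seg by auto
      also have "\<dots> \<le> ?d * (?d * M * norm (y - x)) * norm v"
        using segment_bound(1)[OF that] M0 by (intro mult_right_mono mult_left_mono) auto
      finally show "norm ((?D z - ?D x) v) \<le> ?d * (?d * M * norm (y - x)) * norm v" .
    qed
  qed auto
  then show ?thesis by (simp add: power2_eq_square mult_ac)
qed

lemma C_holder_onD:
  assumes "C_holder_on l \<beta> S f" "2 \<le> l"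
  shows "y \<in> S \<Longrightarrow> f differentiable (at y)"
    "y \<in> S \<Longrightarrow> b \<in> Basis \<Longrightarrow> iter_deriv [b] f differentiable (at y)"
    "continuous_on S f"
proof -
  have d: "set vs \<subseteq> Basis \<Longrightarrow> length vs < l \<Longrightarrow> y \<in> S \<Longrightarrow> iter_deriv vs f differentiable (at y)"
    and c: "set vs \<subseteq> Basis \<Longrightarrow> length vs \<le> l \<Longrightarrow> continuous_on S (iter_deriv vs f)" for vs y
    using assms(1) by (auto simp: C_holder_on_def)
  show "y \<in> S \<Longrightarrow> f differentiable (at y)" using d[of "[]"] assms(2) by simp
  show "y \<in> S \<Longrightarrow> b \<in> Basis \<Longrightarrow> iter_deriv [b] f differentiable (at y)"
    using d[of "[b]"] assms(2) by simp
  show "continuous_on S f" using c[of "[]"] by simp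
qed

text \<open>Only finitely many lists of basis vectors have length at most \<open>l\<close>, and each
  of the corresponding derivatives is continuous, so one bound works for all of them on
  \<open>K\<close>.\<close>

lemma C_holder_on_compact_bound:
  fixes f :: "'a::euclidean_space \<Rightarrow> 'b::real_normed_vector"
  assumes f: "C_holder_on l \<beta> S f" and K: "compact K" "K \<subseteq> S"
  obtains M where "0 \<le> M"
    "\<And>vs y. set vs \<subseteq> Basis \<Longrightarrow> length vs \<le> l \<Longrightarrow> y \<in> K \<Longrightarrow> norm (iter_deriv vs f y) \<le> M"
proof -
  define V where "V = {vs. set vs \<subseteq> (Basis :: 'a set) \<and> length vs \<le> l}"
  have "finite V" unfolding V_def by (intro finite_lists_length_le) simp
  moreover have "bounded (iter_deriv vs f ` K)" if "vs \<in> V" for vs :: "'a list"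
  proof -
    have "continuous_on S (iter_deriv vs f)" using f that by (auto simp: C_holder_on_def V_def)
    then show ?thesis
      using K by (intro compact_imp_bounded compact_continuous_image) (auto intro: continuous_on_subset)
  qed
  ultimately have "bounded (\<Union>vs\<in>V. iter_deriv vs f ` K)" by (intro bounded_UN) auto
  then obtain M where M: "\<And>z. z \<in> (\<Union>vs\<in>V. iter_deriv vs f ` K) \<Longrightarrow> norm z \<le> M"
    unfolding bounded_iff by blast
  show ?thesis
  proof (rule that[of "max 0 M"])
    fix vs :: "'a list" and y assume "set vs \<subseteq> Basis" "length vs \<le> l" "y \<in> K"
    then have "norm (iter_deriv vs f y) \<le> M" by (intro M) (auto simp: V_def)
    then show "norm (iter_deriv vs f y) \<le> max 0 M" by simp
  qed simp
qed

lemma regular_sets_closed: "E \<in> regular_sets l \<beta> \<Longrightarrow> closed E"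
  by (auto simp: regular_sets_def)

text \<open>With \<open>P\<close> the projection along \<open>\<nu>\<close> and \<open>g\<close> the
  local graph function, \<open>u y = y \<bullet> \<nu> - g (P y)\<close> and \<open>D a\<close> is
  its derivative at \<open>a\<close>. The translation rule for \<open>u\<close> expresses that its
  zero set is a graph, and \<open>D a \<nu> = 1\<close> keeps the normal away from zero.\<close>

lemma regular_sets_defining_function:
  fixes E :: "'a::euclidean_space set"
  assumes E: "E \<in> regular_sets l \<beta>" and l: "2 \<le> l" and p: "p \<in> frontier E"
  obtains \<nu> r K \<Lambda> and u :: "'a \<Rightarrow> real" and D :: "'a \<Rightarrow> 'a \<Rightarrow> real" where
    "norm \<nu> = 1" "0 < r" "0 \<le> K" "0 \<le> \<Lambda>"
    "\<And>y. y \<in> ball p r \<Longrightarrow> u y < 0 \<Longrightarrow> y \<in> interior E"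
    "\<And>y. y \<in> ball p r \<Longrightarrow> 0 < u y \<Longrightarrow> y \<notin> E"
    "\<And>y t. u (y + t *\<^sub>R \<nu>) = u y + t"
    "\<And>a. a \<in> ball p r \<Longrightarrow> linear (D a)"
    "\<And>a. a \<in> ball p r \<Longrightarrow> D a \<nu> = 1"
    "\<And>a v. a \<in> ball p r \<Longrightarrow> \<bar>D a v\<bar> \<le> \<Lambda> * norm v"
    "\<And>a y. a \<in> ball p r \<Longrightarrow> y \<in> ball p r \<Longrightarrow> \<bar>u y - u a - D a (y - a)\<bar> \<le> K * (norm (y - a))\<^sup>2"
proof -
  obtain U where U: "open U" "E = closure U" "C_holder_boundary l \<beta> U"
    using E by (auto simp: regular_sets_def)
  \<comment> \<open>The charts are those of the open set \<open>U\<close>; the boundary of its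
    closure is part of its own boundary.\<close>
  have "p \<in> frontier U"
    using p U(1,2) interior_maximal[OF closure_subset U(1)] by (auto simp: frontier_def interior_open)
  then obtain \<nu> r0 and g :: "'a \<Rightarrow> real" where \<nu>: "norm \<nu> = 1" and r0: "0 < r0"
    and g: "C_holder_on l \<beta> (ball (p - (p \<bullet> \<nu>) *\<^sub>R \<nu>) r0) g"
    and gU: "\<And>y. y \<in> ball p r0 \<Longrightarrow> y \<in> U \<longleftrightarrow> y \<bullet> \<nu> < g (y - (y \<bullet> \<nu>) *\<^sub>R \<nu>)"
    using U(3) unfolding C_holder_boundary_def by blast
  define P where "P y = y - (y \<bullet> \<nu>) *\<^sub>R \<nu>" for y
  have \<nu>\<nu>: "\<nu> \<bullet> \<nu> = 1" using \<nu> by (simp add: dot_square_norm)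
  have P_lin: "linear P" unfolding P_def
    by (auto intro!: linearI simp: inner_add_left scaleR_add_left algebra_simps)
  have P_norm: "norm (P v) \<le> norm v" for v
  proof -
    have "P v \<bullet> P v = v \<bullet> v - (v \<bullet> \<nu>)\<^sup>2"
      by (simp add: P_def inner_diff_left inner_diff_right \<nu>\<nu> power2_eq_square inner_commute)
    then show ?thesis by (simp add: norm_le)
  qed
  have P_\<nu>: "P (y + t *\<^sub>R \<nu>) = P y" for y t
    by (simp add: P_def inner_add_left \<nu>\<nu> scaleR_add_left)
  have P_dist: "dist (P p) (P y) \<le> dist p y" for y
    using P_norm[of "p - y"] by (simp add: dist_norm linear_diff[OF P_lin])
  \<comment> \<open>Halving the radius places a compact ball inside the domain of \<open>g\<close>,
    where continuity bounds the derivatives.\<close>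
  define r where "r = r0 / 2"
  have r: "0 < r" "r < r0" using r0 by (auto simp: r_def)
  let ?B = "ball (P p) r" and ?K = "cball (P p) r"
  have K: "?K \<subseteq> ball (P p) r0" using r by auto
  have BK: "?B \<subseteq> ?K" by auto
  have g': "C_holder_on l \<beta> (ball (P p) r0) g" using g by (simp add: P_def)
  note gD = C_holder_onD[OF g' l]
  obtain M where M: "0 \<le> M"
    "\<And>vs y. set vs \<subseteq> Basis \<Longrightarrow> length vs \<le> l \<Longrightarrow> y \<in> ?K \<Longrightarrow> norm (iter_deriv vs g y) \<le> M"
    using C_holder_on_compact_bound[OF g' _ K] by auto
  have M1: "norm (iter_deriv [b] g y) \<le> M" and M2: "norm (iter_deriv [b, c] g y) \<le> M"
    if "b \<in> Basis" "c \<in> Basis" "y \<in> ?K" for b c y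
    using M(2)[of "[b]" y] M(2)[of "[b, c]" y] that l by simp_all
  define u where "u y = y \<bullet> \<nu> - g (P y)" for y
  define D where "D a v = v \<bullet> \<nu> - frechet_derivative g (at (P a)) (P v)" for a v
  define d where "d = real DIM('a)"
  have PB: "P y \<in> ?B" if "y \<in> ball p r" for y
    using P_dist[of y] that by auto
  have g_lin: "linear (frechet_derivative g (at (P a)))" if "a \<in> ball p r" for a
  proof -
    have "P a \<in> ball (P p) r0" using PB[OF that] K BK by blast
    then show ?thesis by (intro linear_frechet_derivative gD)
  qed
  show ?thesis
  proof (rule that[of \<nu> r "d * (d * M)" "1 + d * M" u D])
    show "y \<in> interior E" if y: "y \<in> ball p r" "u y < 0" for y
    proof -
      have "y \<in> U" using gU[of y] y r by (auto simp: u_def P_def)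
      then show ?thesis using U interior_maximal[OF closure_subset U(1)] by blast
    qed
    show "y \<notin> E" if y: "y \<in> ball p r" "0 < u y" for y
    proof -
      have cont: "continuous_on (ball p r) u" unfolding u_def
      proof (intro continuous_intros continuous_on_compose2[OF gD(3)])
        show "continuous_on (ball p r) P" by (rule linear_continuous_on) (use P_lin linear_conv_bounded_linear in blast)
        show "P ` ball p r \<subseteq> ball (P p) r0" using PB K BK by blast
      qed
      \<comment> \<open>The region where \<open>u\<close> is positive is open and misses
        \<open>U\<close>, hence misses the closure of \<open>U\<close>.\<close>
      have op: "open {y \<in> ball p r. 0 < u y}"
        using continuous_open_preimage[OF cont open_ball open_greaterThan[of 0]]
        by (simp add: vimage_def Int_def)
      have "{y \<in> ball p r. 0 < u y} \<inter> U = {}"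
        using gU r by (auto simp: u_def P_def)
      then have "{y \<in> ball p r. 0 < u y} \<inter> closure U = {}"
        using open_Int_closure_eq_empty[OF op] by blast
      then show ?thesis using y U by blast
    qed
    show "u (y + t *\<^sub>R \<nu>) = u y + t" for y t
      by (simp add: u_def P_\<nu> inner_add_left \<nu>\<nu>)
    fix a assume a: "a \<in> ball p r"
    show "linear (D a)"
      unfolding D_def using linear_compose[OF P_lin g_lin[OF a]]
      by (intro linear_compose_sub) (auto simp: o_def intro!: linearI simp: inner_add_left)
    have "P \<nu> = 0" using P_\<nu>[of 0 1] linear_0[OF P_lin] by simp
    then show "D a \<nu> = 1" by (simp add: D_def \<nu>\<nu> linear_0[OF g_lin[OF a]])
    show "\<bar>D a v\<bar> \<le> (1 + d * M) * norm v" for v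
    proof -
      have "norm (frechet_derivative g (at (P a)) (P v)) \<le> d * M * norm (P v)"
        unfolding d_def by (rule linear_norm_le_Basis[OF g_lin[OF a]]) (use M1[OF _ SOME_Basis] PB[OF a] in auto)
      also have "\<dots> \<le> d * M * norm v" using P_norm M(1) by (intro mult_left_mono) (auto simp: d_def)
      finally have "\<bar>frechet_derivative g (at (P a)) (P v)\<bar> \<le> d * M * norm v" by simp
      moreover have "\<bar>v \<bullet> \<nu>\<bar> \<le> norm v" using Cauchy_Schwarz_ineq2[of v \<nu>] \<nu> by simp
      ultimately show ?thesis unfolding D_def ring_distribs by linarith
    qed
    fix y assume y: "y \<in> ball p r"
    have "\<bar>u y - u a - D a (y - a)\<bar> = norm (g (P y) - g (P a) - frechet_derivative g (at (P a)) (P y - P a))"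
      by (simp add: u_def D_def linear_diff[OF P_lin] inner_diff_left)
    also have "\<dots> \<le> d * (d * M) * (norm (P y - P a))\<^sup>2"
      unfolding d_def
    proof (rule C2_bounds[of ?B])
      fix z b c assume z: "z \<in> ?B"
      then have "z \<in> ball (P p) r0" using K BK by blast
      then show "g differentiable (at z)" "b \<in> Basis \<Longrightarrow> iter_deriv [b] g differentiable (at z)"
        by (rule gD)+
      show "b \<in> Basis \<Longrightarrow> c \<in> Basis \<Longrightarrow> norm (iter_deriv [b, c] g z) \<le> M"
        using M2 z BK by blast
    qed (use PB a y in auto)
    also have "\<dots> \<le> d * (d * M) * (norm (y - a))\<^sup>2"
      using P_norm[of "y - a"] M(1) by (intro mult_left_mono power_mono) (auto simp: linear_diff[OF P_lin] d_def)
    finally show "\<bar>u y - u a - D a (y - a)\<bar> \<le> d * (d * M) * (norm (y - a))\<^sup>2" .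
  qed (use \<nu> r M(1) in \<open>auto simp: d_def\<close>)
qed

text \<open>Near each of its points the boundary lies in the zero set of a defining function, which
  is a graph, and bounded graphs are null. The closed ball of radius \<open>r / 4\<close> supplies
  compactness and stays inside \<open>ball p (r / 2)\<close>.\<close>

lemma negligible_frontier_regular_sets:
  fixes E :: "'a::euclidean_space set"
  assumes E: "E \<in> regular_sets l \<beta>" and l: "2 \<le> l"
  shows "negligible (frontier E)"
  unfolding locally_negligible_alt[of "frontier E"]
proof
  fix p assume p: "p \<in> frontier E"
  obtain u :: "'a \<Rightarrow> real" and \<nu> r where \<nu>: "norm \<nu> = 1" and r: "0 < r"
    and u: "\<And>y. y \<in> ball p r \<Longrightarrow> u y < 0 \<Longrightarrow> y \<in> interior E"
      "\<And>y. y \<in> ball p r \<Longrightarrow> 0 < u y \<Longrightarrow> y \<notin> E"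
    and ut: "\<And>y t. u (y + t *\<^sub>R \<nu>) = u y + t"
    using regular_sets_defining_function[OF E l p] by metis
  have "negligible (frontier E \<inter> cball p (r/4))"
  proof (rule negligible_bounded_graph[OF _ \<nu> r, where p=p and u=u])
    show "compact (frontier E \<inter> cball p (r/4))" by (intro closed_Int_compact) auto
    show "u y = 0" if "y \<in> frontier E \<inter> cball p (r/4)" for y
    proof -
      have "y \<in> ball p r" "y \<in> E" "y \<notin> interior E"
        using that r regular_sets_closed[OF E] by (auto simp: frontier_def)
      then show ?thesis using u[of y] by linarith
    qed
  qed (use r ut in auto)
  then have "negligible (frontier E \<inter> ball p (r/4))"
    by (rule negligible_subset) auto
  then show "\<exists>U. openin (top_of_set (frontier E)) U \<and> p \<in> U \<and> negligible U"
    using p r by (intro exI[of _ "frontier E \<inter> ball p (r/4)"]) auto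
qed

section \<open>Images under diffeomorphisms close to the identity\<close>

text \<open>Collects what closeness to the identity provides for images of sets: a homeomorphism
  that moves points by at most \<open>\<eta>\<close>, has a 2-Lipschitz inverse, and has a Taylor
  expansion of first order with constant \<open>M\<close> around invertible linear maps. The
  constants do not depend on the map, so estimates drawn from them are uniform along a
  sequence.\<close>

definition near_identity :: "real \<Rightarrow> real \<Rightarrow> ('a::euclidean_space \<Rightarrow> 'a) \<Rightarrow> bool" where
  "near_identity M \<eta> \<Phi> \<longleftrightarrow>
     bij \<Phi> \<and> continuous_on UNIV \<Phi> \<and> continuous_on UNIV (inv \<Phi>) \<and>
     (\<forall>y. norm (\<Phi> y - y) \<le> \<eta>) \<and>
     (\<forall>y z. norm (y - z) \<le> 2 * norm (\<Phi> y - \<Phi> z)) \<and>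
     (\<exists>D. \<forall>a. linear (D a) \<and> (\<forall>v. norm (D a v - v) \<le> norm v / 2) \<and>
            (\<forall>y. norm (\<Phi> y - \<Phi> a - D a (y - a)) \<le> M * (norm (y - a))\<^sup>2))"

text \<open>Through this the limit set counts as an image of itself and obeys the estimates with the
  same constants as the sets of the sequence.\<close>

lemma near_identity_id: "0 \<le> M \<Longrightarrow> 0 \<le> \<eta> \<Longrightarrow> near_identity M \<eta> (\<lambda>x. x)"
  unfolding near_identity_def using bij_id inv_id
  by (intro conjI exI[of _ "\<lambda>a v. v"]) (auto simp: id_def linear_ident)

lemma near_identity_open_image:
  assumes "near_identity M \<eta> \<Phi>" "open W"
  shows "open (\<Phi> ` W)"
proof -
  have "\<Phi> ` W = inv \<Phi> -` W"
    using assms(1) by (simp add: near_identity_def bij_vimage_eq_inv_image bij_imp_bij_inv inv_inv_eq)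
  then show ?thesis using assms by (simp add: near_identity_def open_vimage)
qed

text \<open>The triangle inequality gives \<open>norm v \<le> 2 * norm (A v)\<close>. Hence
  \<open>A\<close> is injective, in finite dimension also surjective, and the same inequality bounds
  the inverse.\<close>

lemma near_inverse_linear:
  fixes A :: "'a::euclidean_space \<Rightarrow> 'a"
  assumes A: "linear A" and near: "\<And>v. norm (A v - v) \<le> norm v / 2"
  obtains B where "linear B" "\<And>v. B (A v) = v" "\<And>v. norm (B v) \<le> 2 * norm v"
proof -
  have low: "norm v \<le> 2 * norm (A v)" for v
    using near[of v] norm_triangle_ineq2[of v "A v"] norm_minus_commute[of v "A v"] by linarith
  have "inj A"
  proof (rule injI)
    fix v w assume "A v = A w"
    then show "v = w" using low[of "v - w"] by (simp add: linear_diff[OF A])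
  qed
  then obtain B where B: "linear B" "\<And>v. B (A v) = v"
    using linear_injective_left_inverse[OF A] by (metis comp_apply id_apply)
  have "surj A" using A \<open>inj A\<close> by (rule linear_inj_imp_surj)
  then have "norm (B v) \<le> 2 * norm v" for v
    using low B(2) by (metis surjD)
  with B show ?thesis by (intro that)
qed

text \<open>With \<open>a = \<Phi>\<^sup>-\<^sup>1 x\<close>, the function \<open>u \<circ> \<Phi>\<^sup>-\<^sup>1\<close>, where \<open>u\<close> defines \<open>E\<close> near \<open>x\<close>, defines \<open>\<Phi> E\<close> near \<open>x\<close>
  and agrees to second order with the linear functional \<open>D\<^sub>a \<circ> B\<close>, \<open>B\<close> being the inverse of the
  derivative of \<open>\<Phi>\<close> at \<open>a\<close>.\<close>

lemma nearly_halfspace_image: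
  fixes E :: "'a::euclidean_space set"
  assumes E: "E \<in> regular_sets l \<beta>" and l: "2 \<le> l" and x: "x \<in> frontier E" and M: "0 \<le> M"
  obtains C \<delta> \<eta> where "0 < C" "0 < \<delta>" "0 < \<eta>"
    "\<And>\<Phi>. near_identity M \<eta> \<Phi> \<Longrightarrow> x \<in> frontier (\<Phi> ` E) \<Longrightarrow> nearly_halfspace C \<delta> x (\<Phi> ` E)"
proof -
  obtain \<nu> r K \<Lambda> and u :: "'a \<Rightarrow> real" and D :: "'a \<Rightarrow> 'a \<Rightarrow> real" where
    \<nu>: "norm \<nu> = 1" and r: "0 < r" and K: "0 \<le> K" and \<Lambda>: "0 \<le> \<Lambda>"
    and un: "\<And>y. y \<in> ball x r \<Longrightarrow> u y < 0 \<Longrightarrow> y \<in> interior E"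
    and up: "\<And>y. y \<in> ball x r \<Longrightarrow> 0 < u y \<Longrightarrow> y \<notin> E"
    and ut: "\<And>y t. u (y + t *\<^sub>R \<nu>) = u y + t"
    and D: "\<And>a. a \<in> ball x r \<Longrightarrow> linear (D a)"
      "\<And>a. a \<in> ball x r \<Longrightarrow> D a \<nu> = 1"
      "\<And>a v. a \<in> ball x r \<Longrightarrow> \<bar>D a v\<bar> \<le> \<Lambda> * norm v"
    and Taylor: "\<And>a y. a \<in> ball x r \<Longrightarrow> y \<in> ball x r \<Longrightarrow> \<bar>u y - u a - D a (y - a)\<bar> \<le> K * (norm (y - a))\<^sup>2"
    by (rule regular_sets_defining_function[OF E l x], rule that)
  \<comment> \<open>For \<open>y = inv \<Phi> (x + z)\<close> one has
    \<open>norm (y - a) \<le> 2 * norm z\<close>. The Taylor error of \<open>\<Phi>\<close> then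
    passes through \<open>B\<close>, of norm at most \<open>2\<close>, and \<open>D a\<close>, of
    norm at most \<open>\<Lambda>\<close>, giving \<open>8 * M * \<Lambda>\<close>; that of
    \<open>u\<close> gives \<open>4 * K\<close>. The summand \<open>1\<close> makes the final
    inequality strict.\<close>
  define C where "C = 8 * M * \<Lambda> + 4 * K + 1"
  show ?thesis
  \<comment> \<open>With these radii \<open>a\<close> is within \<open>r / 4\<close> of
    \<open>x\<close> and \<open>y\<close> within \<open>r / 2\<close> of \<open>a\<close>, so both
    stay in \<open>ball x r\<close>.\<close>
  proof (rule that[of C "r/4" "r/4"])
    show "0 < C" "0 < r/4" "0 < r/4" using M K \<Lambda> r by (auto simp: C_def add_nonneg_pos)
    fix \<Phi> assume \<Phi>: "near_identity M (r/4) \<Phi>" and xfr: "x \<in> frontier (\<Phi> ` E)"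
    then have bij: "bij \<Phi>" and near: "\<And>y. norm (\<Phi> y - y) \<le> r/4"
      and expand: "\<And>y z. norm (y - z) \<le> 2 * norm (\<Phi> y - \<Phi> z)"
      unfolding near_identity_def by auto
    define a where "a = inv \<Phi> x"
    have \<Phi>a: "\<Phi> a = x" using bij by (simp add: a_def bij_is_surj surj_f_inv_f)
    have a_near: "norm (x - a) \<le> r/4" using near[of a] by (simp add: \<Phi>a)
    then have a: "a \<in> ball x r" using r by (simp add: dist_norm)
    obtain A where A: "linear A" "\<And>v. norm (A v - v) \<le> norm v / 2"
      "\<And>y. norm (\<Phi> y - \<Phi> a - A (y - a)) \<le> M * (norm (y - a))\<^sup>2"
      using \<Phi> unfolding near_identity_def by blast
    obtain B where B: "linear B" "\<And>v. B (A v) = v" "\<And>v. norm (B v) \<le> 2 * norm v"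
      using near_inverse_linear[OF A(1,2)] by metis
    have mem: "y \<in> \<Phi> ` E \<longleftrightarrow> inv \<Phi> y \<in> E" for y
      using bij by (metis bij_inv_eq_iff image_iff)
    \<comment> \<open>Otherwise \<open>a\<close> would be interior to \<open>E\<close> or to its
      complement, and the homeomorphism would make \<open>x\<close> interior to the image or to its
      complement.\<close>
    have ua: "u a = 0"
    proof (rule ccontr)
      assume "u a \<noteq> 0"
      then consider "u a < 0" | "0 < u a" by linarith
      then show False
      proof cases
        case 1
        have "\<Phi> a \<in> \<Phi> ` interior E" using un[OF a 1] by simp
        moreover have "open (\<Phi> ` interior E)" using near_identity_open_image[OF \<Phi>] by simp
        ultimately have "x \<in> interior (\<Phi> ` E)"
          unfolding \<Phi>a using interior_maximal[of "\<Phi> ` interior E" "\<Phi> ` E"] interior_subset by blast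
        then show False using xfr by (simp add: frontier_def)
      next
        case 2
        have "\<Phi> a \<in> \<Phi> ` (- E)" using up[OF a 2] by simp
        moreover have "open (\<Phi> ` (- E))"
          using near_identity_open_image[OF \<Phi>] regular_sets_closed[OF E] by (simp add: open_Compl)
        ultimately have "x \<in> interior (- (\<Phi> ` E))"
          unfolding \<Phi>a using interior_maximal[of "\<Phi> ` (- E)" "- (\<Phi> ` E)"] bij_image_Compl_eq[OF bij, of E] by auto
        then show False using xfr by (simp add: frontier_def interior_complement)
      qed
    qed
    \<comment> \<open>\<open>q\<close> represents the functional \<open>D a \<circ> B\<close> as an
      inner product; it is the gradient at \<open>x\<close> of \<open>u\<close> composed with the
      inverse of \<open>\<Phi>\<close>.\<close>
    define q where "q = adjoint (D a \<circ> B) 1"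
    have DB: "linear (D a \<circ> B)" by (rule linear_compose[OF B(1) D(1)[OF a]])
    have q: "q \<bullet> v = D a (B v)" for v
      using adjoint_works[OF DB, of v 1] by (simp add: q_def inner_commute)
    \<comment> \<open>The vector \<open>A \<nu>\<close> has norm at most \<open>2\<close>, while its
      inner product with \<open>q\<close> is \<open>D a \<nu> = 1\<close>.\<close>
    have q_low: "1/2 \<le> norm q"
    proof -
      have "q \<bullet> A \<nu> = 1" by (simp add: q B(2) D(2)[OF a])
      moreover have "norm (A \<nu>) \<le> 2"
        using A(2)[of \<nu>] \<nu> norm_triangle_ineq2[of "A \<nu>" \<nu>] by simp
      ultimately show ?thesis
        using Cauchy_Schwarz_ineq2[of q "A \<nu>"] mult_left_mono[of "norm (A \<nu>)" 2 "norm q"] by simp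
    qed
    have approx: "\<bar>u (inv \<Phi> (x + z)) - q \<bullet> z\<bar> < C * (norm z)\<^sup>2 \<and> inv \<Phi> (x + z) \<in> ball x r"
      if z: "norm z < r/4" "z \<noteq> 0" for z
    proof
      define y where "y = inv \<Phi> (x + z)"
      have \<Phi>y: "\<Phi> y = x + z" using bij by (simp add: y_def bij_is_surj surj_f_inv_f)
      have wz: "norm (y - a) \<le> 2 * norm z" using expand[of y a] by (simp add: \<Phi>y \<Phi>a)
      then have sq: "(norm (y - a))\<^sup>2 \<le> 4 * (norm z)\<^sup>2"
        using power_mono[OF wz, of 2] by (simp add: power_mult_distrib)
      have "norm (x - y) \<le> norm (x - a) + norm (y - a)"
        using norm_triangle_ineq4[of "x - a" "y - a"] by simp
      then show y: "inv \<Phi> (x + z) \<in> ball x r"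
        using a_near wz z r by (simp add: dist_norm flip: y_def)
      have "norm (B (z - A (y - a))) \<le> 2 * (M * (norm (y - a))\<^sup>2)"
        using B(3)[of "z - A (y - a)"] A(3)[of y] by (simp add: \<Phi>y \<Phi>a)
      also have "\<dots> \<le> 2 * (M * (4 * (norm z)\<^sup>2))" using sq M by (intro mult_left_mono) auto
      finally have "norm (B z - (y - a)) \<le> 8 * M * (norm z)\<^sup>2"
        by (simp add: linear_diff[OF B(1)] B(2))
      then have "\<Lambda> * norm (B z - (y - a)) \<le> \<Lambda> * (8 * M * (norm z)\<^sup>2)"
        using \<Lambda> by (rule mult_left_mono)
      then have "\<bar>D a (B z) - D a (y - a)\<bar> \<le> 8 * M * \<Lambda> * (norm z)\<^sup>2"
        using D(3)[OF a, of "B z - (y - a)"] by (simp add: linear_diff[OF D(1)[OF a]] mult_ac)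
      moreover have "\<bar>u y - D a (y - a)\<bar> \<le> 4 * K * (norm z)\<^sup>2"
        using Taylor[OF a, of y] y mult_left_mono[OF sq K] by (simp add: ua flip: y_def)
      moreover have "0 < (norm z)\<^sup>2" using z by simp
      ultimately show "\<bar>u (inv \<Phi> (x + z)) - q \<bullet> z\<bar> < C * (norm z)\<^sup>2"
        unfolding q C_def y_def[symmetric] distrib_right by linarith
    qed
    show "nearly_halfspace C (r/4) x (\<Phi> ` E)"
      unfolding nearly_halfspace_def
    proof (intro exI[of _ q] conjI allI impI q_low)
      fix z assume z: "norm z < r/4" and big: "C * (norm z)\<^sup>2 < \<bar>q \<bullet> z\<bar>"
      have z0: "z \<noteq> 0" using big by auto
      have p1: "\<bar>u (inv \<Phi> (x + z)) - q \<bullet> z\<bar> < C * (norm z)\<^sup>2" "inv \<Phi> (x + z) \<in> ball x r"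
        and p2: "\<bar>u (inv \<Phi> (x - z)) + q \<bullet> z\<bar> < C * (norm z)\<^sup>2" "inv \<Phi> (x - z) \<in> ball x r"
        using approx[of z] approx[of "- z"] z z0 by auto
      have E_iff: "y \<in> E \<longleftrightarrow> u y < 0" if "y \<in> ball x r" "u y \<noteq> 0" for y
        using un[OF that(1)] up[OF that(1)] that(2) interior_subset[of E] by (meson linorder_neqE_linordered_idom less_asym subsetD)
      \<comment> \<open>The two values differ from \<open>q \<bullet> z\<close> and from its
        negative by less than the absolute value of \<open>q \<bullet> z\<close>, so they are
        nonzero and of opposite sign.\<close>
      have "u (inv \<Phi> (x + z)) \<noteq> 0" "u (inv \<Phi> (x - z)) \<noteq> 0"
        "u (inv \<Phi> (x + z)) < 0 \<longleftrightarrow> \<not> u (inv \<Phi> (x - z)) < 0"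
        using p1(1) p2(1) big by linarith+
      then show "x + z \<in> \<Phi> ` E \<longleftrightarrow> x - z \<notin> \<Phi> ` E"
        unfolding mem using E_iff[OF p1(2)] E_iff[OF p2(2)] by blast
    qed
  qed
qed

section \<open>Diffeomorphisms converging to the identity\<close>

lemma iter_deriv_ident:
  "iter_deriv [b] (\<lambda>x::'a::real_normed_vector. x) = (\<lambda>_. b)"
  "iter_deriv [b, c] (\<lambda>x::'a. x) = (\<lambda>_. 0)"
proof -
  have "frechet_derivative (\<lambda>x::'a. x) (at y) = (\<lambda>v. v)" for y
    by (rule frechet_derivative_at[symmetric]) (rule has_derivative_ident)
  moreover have "frechet_derivative (\<lambda>x::'a. b) (at y) = (\<lambda>v. 0)" for y
    by (rule frechet_derivative_at[symmetric]) (rule has_derivative_const)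
  ultimately show "iter_deriv [b] (\<lambda>x::'a. x) = (\<lambda>_. b)" "iter_deriv [b, c] (\<lambda>x::'a. x) = (\<lambda>_. 0)"
    by simp_all
qed

text \<open>Uniform convergence of order zero gives \<open>\<eta>\<close>. Order one, with
  \<open>1 / (2 * DIM('a))\<close> on each basis vector, puts the derivative within
  \<open>1/2\<close> of the identity. Order two bounds the second derivatives by \<open>1\<close>,
  whence the Taylor constant. By the mean value inequality the map minus the identity is a
  contraction with factor \<open>1/2\<close>, which yields the expansion estimate with factor
  \<open>2\<close>.\<close>

lemma eventually_near_identity:
  fixes \<Phi> :: "nat \<Rightarrow> 'a::euclidean_space \<Rightarrow> 'a"
  assumes diff: "\<And>n. C_holder_diffeo l \<beta> (\<Phi> n)" and conv: "C_holder_converges l \<beta> \<Phi> (\<lambda>x. x)"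
    and l: "2 \<le> l" and \<eta>: "0 < \<eta>"
  shows "\<forall>\<^sub>F n in sequentially. near_identity ((real DIM('a))\<^sup>2) \<eta> (\<Phi> n)"
proof -
  let ?d = "real DIM('a)"
  have d: "0 < ?d" by simp
  have lim: "\<forall>\<^sub>F n in sequentially. \<forall>y. dist (iter_deriv vs (\<Phi> n) y) (iter_deriv vs (\<lambda>x. x) y) < e"
    if "set vs \<subseteq> Basis" "length vs \<le> 2" "0 < e" for vs e
    using conv that l unfolding C_holder_converges_def uniform_limit_iff by force
  have "\<forall>\<^sub>F n in sequentially. \<forall>y. norm (\<Phi> n y - y) < \<eta>"
    using lim[of "[]" \<eta>] \<eta> by (simp add: dist_norm)
  moreover have "\<forall>\<^sub>F n in sequentially. \<forall>b\<in>Basis. \<forall>y. norm (iter_deriv [b] (\<Phi> n) y - b) < 1 / (2 * ?d)"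
    using lim[of "[_]" "1 / (2 * ?d)"] d unfolding iter_deriv_ident dist_norm
    by (intro eventually_ball_finite) auto
  moreover have "\<forall>\<^sub>F n in sequentially. \<forall>b\<in>Basis. \<forall>c\<in>Basis. \<forall>y. norm (iter_deriv [b, c] (\<Phi> n) y) < 1"
    using lim[of "[_, _]" 1] unfolding iter_deriv_ident dist_norm
    by (intro eventually_ball_finite ballI) auto
  ultimately show ?thesis
  proof eventually_elim
    case (elim n)
    let ?D = "\<lambda>a. frechet_derivative (\<Phi> n) (at a)"
    have hol: "C_holder_on l \<beta> UNIV (\<Phi> n)" "C_holder_on l \<beta> UNIV (inv (\<Phi> n))" and bij: "bij (\<Phi> n)"
      using diff[of n] by (auto simp: C_holder_diffeo_def)
    note C = C_holder_onD[OF hol(1) l]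
    have lin: "linear (?D a)" for a by (intro linear_frechet_derivative C) simp
    have D_near: "norm (?D a v - v) \<le> norm v / 2" for a v
    proof -
      have "norm (?D a v - v) \<le> ?d * (1 / (2 * ?d)) * norm v"
        by (rule linear_norm_le_Basis[of "\<lambda>v. ?D a v - v"])
           (use elim(2) in \<open>auto intro!: linear_compose_sub lin linear_ident simp: less_imp_le\<close>)
      then show ?thesis by simp
    qed
    have Taylor: "norm (\<Phi> n y - \<Phi> n a - ?D a (y - a)) \<le> ?d\<^sup>2 * (norm (y - a))\<^sup>2" for a y
      using C2_bounds[of UNIV "\<Phi> n" 1 a y] C elim(3) by (auto simp: power2_eq_square less_imp_le)
    have contraction: "norm ((\<Phi> n y - y) - (\<Phi> n z - z)) \<le> 1/2 * norm (y - z)" for y z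
    proof (rule differentiable_bound[of UNIV "\<lambda>y. \<Phi> n y - y" "\<lambda>a v. ?D a v - v"])
      show "((\<lambda>y. \<Phi> n y - y) has_derivative (\<lambda>v. ?D a v - v)) (at a within UNIV)" for a
        using C(1)[of a] frechet_derivative_works by (auto intro!: derivative_intros)
      show "onorm (\<lambda>v. ?D a v - v) \<le> 1/2" for a
        using D_near[of a] by (intro onorm_le) simp
    qed auto
    have "norm (y - z) \<le> 2 * norm (\<Phi> n y - \<Phi> n z)" for y z
    proof -
      have "norm (y - z) \<le> norm (\<Phi> n y - \<Phi> n z) + norm ((\<Phi> n y - y) - (\<Phi> n z - z))"
        using norm_triangle_ineq4[of "\<Phi> n y - \<Phi> n z" "(\<Phi> n y - y) - (\<Phi> n z - z)"] by (simp add: algebra_simps)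
      then show ?thesis using contraction[of y z] by linarith
    qed
    then show ?case
      unfolding near_identity_def
      using bij C(3) C_holder_onD(3)[OF hol(2) l] elim(1) lin D_near Taylor
      by (auto intro!: exI[of _ ?D] simp: less_imp_le)
  qed
qed

text \<open>Some ball around \<open>y\<close> lies entirely in \<open>E\<close> or in its
  complement, and the preimage of \<open>y\<close> is eventually in that ball, because the map
  displaces the preimage by at most half the radius.\<close>

lemma eventually_mem_image_iff:
  fixes y :: "'a::euclidean_space"
  assumes bij: "\<And>n. bij (\<Phi> n)"
    and conv: "\<And>\<eta>. 0 < \<eta> \<Longrightarrow> \<forall>\<^sub>F n in sequentially. \<forall>y. norm (\<Phi> n y - y) \<le> \<eta>"
    and y: "y \<notin> frontier E"
  shows "\<forall>\<^sub>F n in sequentially. y \<in> \<Phi> n ` E \<longleftrightarrow> y \<in> E"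
proof -
  have "y \<in> interior E \<or> y \<in> interior (- E)"
    using y by (auto simp: frontier_def interior_complement)
  then obtain e where e: "0 < e" "ball y e \<subseteq> E \<or> ball y e \<subseteq> - E"
    unfolding mem_interior by blast
  show ?thesis using conv[of "e/2", OF half_gt_zero[OF e(1)]]
  proof eventually_elim
    case (elim n)
    have \<Phi>: "\<Phi> n (inv (\<Phi> n) y) = y" using bij[of n] by (simp add: bij_is_surj surj_f_inv_f)
    have "inv (\<Phi> n) y \<in> ball y e"
      using elim[rule_format, of "inv (\<Phi> n) y"] e(1) by (simp add: \<Phi> dist_norm)
    moreover have "y \<in> ball y e" using e by simp
    moreover have "y \<in> \<Phi> n ` E \<longleftrightarrow> inv (\<Phi> n) y \<in> E"
      using inj_image_mem_iff[OF bij_is_inj[OF bij[of n]], of "inv (\<Phi> n) y" E] by (simp add: \<Phi>)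
    ultimately show ?case using e(2) by (meson ComplD subsetD)
  qed
qed

section \<open>Convergence of the curvatures\<close>

text \<open>From \<open>R\<close> on the expression under the outer limit is constantly
  \<open>H\<close>.\<close>

lemma Lim_at_top_Lim_diff_eq:
  fixes f :: "real \<Rightarrow> real \<Rightarrow> real"
  assumes "\<And>R'. R \<le> R' \<Longrightarrow> (f R' \<longlongrightarrow> H + g R') (at_right 0)"
  shows "Lim at_top (\<lambda>R. Lim (at_right 0) (f R) - g R) = H"
proof (rule tendsto_Lim)
  show "((\<lambda>R. Lim (at_right 0) (f R) - g R) \<longlongrightarrow> H) at_top"
  proof (rule tendsto_eventually)
    show "\<forall>\<^sub>F R' in at_top. Lim (at_right 0) (f R') - g R' = H"
      using eventually_ge_at_top[of R]
    proof eventually_elim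
      case (elim R')
      then have "Lim (at_right 0) (f R') = H + g R'"
        using assms by (intro tendsto_Lim) auto
      then show ?case by simp
    qed
  qed
qed simp

lemma not_bounded_Compl:
  fixes E :: "'a::euclidean_space set"
  assumes "bounded E" shows "\<not> bounded (- E)"
  using assms not_bounded_UNIV[where 'a='a] bounded_Un[of E "- E"] by auto

lemma zero_curvature_bounded:
  fixes E :: "'a::euclidean_space set"
  assumes "bounded E"
    and "\<And>R'. R \<le> R' \<Longrightarrow> (annular_integral x E R' \<longlongrightarrow> H + d_omega TYPE('a) * ln R') (at_right 0)"
  shows "zero_curvature x E = H"
  using assms(1) Lim_at_top_Lim_diff_eq[OF assms(2)] by (simp add: zero_curvature_def)

text \<open>Exchanging a set with its complement reverses the sign of the integrand and with it that
  of the logarithm, which matches the plus sign in the second case of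
  \<open>zero_curvature\<close>.\<close>

lemma zero_curvature_bounded_Compl:
  fixes E :: "'a::euclidean_space set"
  assumes E: "bounded (- E)"
    and lim: "\<And>R'. R \<le> R' \<Longrightarrow> (annular_integral x (- E) R' \<longlongrightarrow> H + d_omega TYPE('a) * ln R') (at_right 0)"
  shows "zero_curvature x E = - H"
proof -
  have "annular_integral x E R' = (\<lambda>r. - annular_integral x (- E) R' r)" for R'
    by (simp add: annular_integral_Compl)
  then have "(annular_integral x E R' \<longlongrightarrow> - H + - (d_omega TYPE('a) * ln R')) (at_right 0)" if "R \<le> R'" for R'
    using tendsto_minus[OF lim[OF that]] by simp
  from Lim_at_top_Lim_diff_eq[OF this] show ?thesis
    using not_bounded_Compl[OF E] E by (simp add: zero_curvature_def)
qed

lemma eventually_image_subset_ball: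
  fixes A :: "'a::euclidean_space set"
  assumes A: "bounded A"
    and conv: "\<And>\<eta>. 0 < \<eta> \<Longrightarrow> \<forall>\<^sub>F n in sequentially. \<forall>y. norm (\<Phi> n y - y) \<le> \<eta>"
  obtains R where "0 < R" "A \<subseteq> ball x R" "\<forall>\<^sub>F n in sequentially. \<Phi> n ` A \<subseteq> ball x R"
proof -
  obtain R where R: "0 < R" "A \<subseteq> ball x R" using bounded_subset_ballD[OF A] by blast
  have "\<forall>\<^sub>F n in sequentially. \<Phi> n ` A \<subseteq> ball x (R + 1)"
    using conv[OF zero_less_one]
  proof eventually_elim
    case (elim n)
    show ?case
    proof clarify
      fix y assume "y \<in> A"
      then have "dist x y < R" "dist y (\<Phi> n y) \<le> 1"
        using R(2) elim by (auto simp: dist_norm norm_minus_commute)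
      then show "\<Phi> n y \<in> ball x (R + 1)"
        using dist_triangle[of x "\<Phi> n y" y] by simp
    qed
  qed
  then show ?thesis using R by (intro that[of "R + 1"]) auto
qed

lemma tendsto_mult_of_diff_divide:
  fixes s K :: "nat \<Rightarrow> real"
  assumes lim: "(\<lambda>n. K n - c / s n) \<longlonglongrightarrow> H" and s: "s \<longlonglongrightarrow> 0" "\<And>n. s n \<noteq> 0"
  shows "(\<lambda>n. s n * K n) \<longlonglongrightarrow> c"
proof -
  have "(\<lambda>n. s n * (K n - c / s n) + c) \<longlonglongrightarrow> 0 * H + c"
    by (intro tendsto_intros lim s)
  moreover have "s n * (K n - c / s n) + c = s n * K n" for n
    using s(2)[of n] by (simp add: field_simps)
  ultimately show ?thesis by simp
qed

text \<open>The singular term has opposite signs in the two cases: as \<open>s\<close> increases to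
  \<open>0\<close>, minus twice the potential of a bounded \<open>E\<close> tends to minus infinity
  like \<open>d_omega / s\<close>, whereas twice the potential of a bounded complement tends to plus
  infinity like \<open>- d_omega / s\<close>. The cases are separate implications because on the
  line a set with compact boundary, such as a half-line, may be unbounded together with its
  complement.\<close>

theorem theorem5p4:
  fixes E :: "'a::euclidean_space set" and En :: "nat \<Rightarrow> 'a set"
    and s :: "nat \<Rightarrow> real" and l :: nat and \<beta> :: real and x :: 'a
  assumes "2 \<le> l" and "0 \<le> \<beta>" and "\<beta> \<le> 1"
    and "\<And>n. s n \<in> {- real DIM('a)<..<0}"
    and "filterlim s (at_left 0) sequentially"
    and "\<And>n. En n \<in> regular_sets l \<beta>"
    and "E \<in> regular_sets l \<beta>"
    and "regular_sets_converge l \<beta> En E"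
    and "x \<in> frontier E" and "\<And>n. x \<in> frontier (En n)"
  shows
    "(bounded E \<longrightarrow>
       (\<lambda>n. riesz_curvature (s n) x (En n) - d_omega TYPE('a) / s n) \<longlonglongrightarrow> zero_curvature x E \<and>
       (\<lambda>n. s n * riesz_curvature (s n) x (En n)) \<longlonglongrightarrow> d_omega TYPE('a)) \<and>
     (bounded (- E) \<longrightarrow>
       (\<lambda>n. riesz_curvature (s n) x (En n) + d_omega TYPE('a) / s n) \<longlonglongrightarrow> zero_curvature x E \<and>
       (\<lambda>n. s n * riesz_curvature (s n) x (En n)) \<longlonglongrightarrow> - d_omega TYPE('a))"
proof -
  note l = assms(1) and E = assms(7) and x = assms(9)
  obtain \<Phi> where diff: "\<And>n. C_holder_diffeo l \<beta> (\<Phi> n)" and En: "\<And>n. En n = \<Phi> n ` E"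
    and conv: "C_holder_converges l \<beta> \<Phi> (\<lambda>x. x)"
    using assms(8) unfolding regular_sets_converge_def by blast
  have s: "\<And>n. - real DIM('a) < s n" "\<And>n. s n < 0" "s \<longlonglongrightarrow> 0"
    using assms(4,5) by (auto simp: filterlim_at)
  then have s0: "s n \<noteq> 0" for n by (metis less_irrefl)
  let ?M = "(real DIM('a))\<^sup>2"
  have bij: "bij (\<Phi> n)" for n using diff[of n] by (simp add: C_holder_diffeo_def)
  have near: "\<forall>\<^sub>F n in sequentially. near_identity ?M \<eta> (\<Phi> n)" if "0 < \<eta>" for \<eta>
    by (rule eventually_near_identity[OF diff conv l that])
  have unif: "\<forall>\<^sub>F n in sequentially. \<forall>y. norm (\<Phi> n y - y) \<le> \<eta>" if "0 < \<eta>" for \<eta>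
    using near[OF that] by eventually_elim (simp add: near_identity_def)
  obtain C \<delta> \<eta> where C: "0 < C" "0 < \<delta>" "0 < \<eta>"
    and half: "\<And>\<Phi>. near_identity ?M \<eta> \<Phi> \<Longrightarrow> x \<in> frontier (\<Phi> ` E) \<Longrightarrow> nearly_halfspace C \<delta> x (\<Phi> ` E)"
    using nearly_halfspace_image[OF E l x zero_le_power2] by metis
  have half_E: "nearly_halfspace C \<delta> x E"
    using half[OF near_identity_id] C(3) x by simp
  have half_En: "\<forall>\<^sub>F n in sequentially. nearly_halfspace C \<delta> x (En n)"
    using near[OF C(3)] by eventually_elim (use half assms(10) En in metis)
  \<comment> \<open>Membership in \<open>En n\<close> settles off the frontier of \<open>E\<close>
    only, so pointwise convergence almost everywhere rests on this frontier being null.\<close>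
  have "frontier E \<in> null_sets lborel"
    using negligible_frontier_regular_sets[OF E l]
    by (simp add: negligible_iff_null_sets null_sets_completion_iff borel_closed)
  then have ae: "AE y in lborel. \<forall>\<^sub>F n in sequentially. y \<in> En n \<longleftrightarrow> y \<in> E"
    by (rule AE_not_in[THEN eventually_mono])
       (simp add: En eventually_mem_image_iff[OF bij unif])
  have borel: "E \<in> sets borel" "\<And>n. En n \<in> sets borel"
    using regular_sets_closed E assms(6) by (blast intro: borel_closed)+
  show ?thesis
  proof (intro conjI[of "_ \<longrightarrow> _"] impI)
    assume bdd: "bounded E"
    obtain R where R: "0 < R" "E \<subseteq> ball x R" "\<forall>\<^sub>F n in sequentially. En n \<subseteq> ball x R"
      by (rule eventually_image_subset_ball[OF bdd, of \<Phi> x], erule unif, rule that) (auto simp: En)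
    obtain H where H:
      "(\<lambda>n. - 2 * (LINT y:En n|lborel. 1 / norm (x - y) powr (real DIM('a) + s n)) - d_omega TYPE('a) / s n) \<longlonglongrightarrow> H"
      "\<And>R'. R \<le> R' \<Longrightarrow> (annular_integral x E R' \<longlongrightarrow> H + d_omega TYPE('a) * ln R') (at_right 0)"
      by (rule riesz_potential_tendsto[OF borel R ae C(1,2) half_E half_En s], rule that)
    have lim: "(\<lambda>n. riesz_curvature (s n) x (En n) - d_omega TYPE('a) / s n) \<longlonglongrightarrow> H"
    proof (rule Lim_transform_eventually[OF H(1)])
      show "\<forall>\<^sub>F n in sequentially. - 2 * (LINT y:En n|lborel. 1 / norm (x - y) powr (real DIM('a) + s n))
          - d_omega TYPE('a) / s n = riesz_curvature (s n) x (En n) - d_omega TYPE('a) / s n"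
        using R(3)
      proof eventually_elim
        case (elim n)
        then have "bounded (En n)" by (rule bounded_subset[OF bounded_ball])
        then show ?case by (simp add: riesz_curvature_def)
      qed
    qed
    then show "(\<lambda>n. riesz_curvature (s n) x (En n) - d_omega TYPE('a) / s n) \<longlonglongrightarrow> zero_curvature x E \<and>
        (\<lambda>n. s n * riesz_curvature (s n) x (En n)) \<longlonglongrightarrow> d_omega TYPE('a)"
      using zero_curvature_bounded[OF bdd H(2)] tendsto_mult_of_diff_divide[OF lim s(3) s0] by simp
  next
    assume bdd: "bounded (- E)"
    have En': "- En n = \<Phi> n ` (- E)" for n by (simp add: En bij_image_Compl_eq[OF bij])
    obtain R where R: "0 < R" "- E \<subseteq> ball x R" "\<forall>\<^sub>F n in sequentially. - En n \<subseteq> ball x R"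
      by (rule eventually_image_subset_ball[OF bdd, of \<Phi> x], erule unif, rule that) (auto simp: En')
    obtain H where H:
      "(\<lambda>n. - 2 * (LINT y:- En n|lborel. 1 / norm (x - y) powr (real DIM('a) + s n)) - d_omega TYPE('a) / s n) \<longlonglongrightarrow> H"
      "\<And>R'. R \<le> R' \<Longrightarrow> (annular_integral x (- E) R' \<longlongrightarrow> H + d_omega TYPE('a) * ln R') (at_right 0)"
    proof (rule riesz_potential_tendsto[where A="- E" and An="\<lambda>n. - En n", OF _ _ R _ C(1,2) _ _ s])
      show "AE y in lborel. \<forall>\<^sub>F n in sequentially. y \<in> - En n \<longleftrightarrow> y \<in> - E" using ae by simp
    qed (use borel half_E half_En in \<open>auto simp: nearly_halfspace_Compl\<close>)
    \<comment> \<open>Here the Riesz curvature is the negative of the quantity in \<open>H\<close>,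
      which is taken for the bounded complements.\<close>
    have "(\<lambda>n. riesz_curvature (s n) x (En n) - (- d_omega TYPE('a)) / s n) \<longlonglongrightarrow> - H"
    proof (rule Lim_transform_eventually[OF tendsto_minus[OF H(1)]])
      show "\<forall>\<^sub>F n in sequentially. - (- 2 * (LINT y:- En n|lborel. 1 / norm (x - y) powr (real DIM('a) + s n))
          - d_omega TYPE('a) / s n) = riesz_curvature (s n) x (En n) - (- d_omega TYPE('a)) / s n"
        using R(3)
      proof eventually_elim
        case (elim n)
        then have "bounded (- En n)" by (rule bounded_subset[OF bounded_ball])
        then show ?case using not_bounded_Compl[of "- En n"] by (simp add: riesz_curvature_def)
      qed
    qed
    moreover from this have "(\<lambda>n. s n * riesz_curvature (s n) x (En n)) \<longlonglongrightarrow> - d_omega TYPE('a)"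
      by (rule tendsto_mult_of_diff_divide[OF _ s(3) s0])
    ultimately show "(\<lambda>n. riesz_curvature (s n) x (En n) + d_omega TYPE('a) / s n) \<longlonglongrightarrow> zero_curvature x E \<and>
        (\<lambda>n. s n * riesz_curvature (s n) x (En n)) \<longlonglongrightarrow> - d_omega TYPE('a)"
      using zero_curvature_bounded_Compl[OF bdd H(2)] by simp
  qed
qed

end
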